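(* If a real $x>0$ is a zero of some Martin-Löf random path $B$ (i.e. $B(x)=0$), then \[\sum_n 2^{-K(x\upharpoonright n)+n/2}<\infty.\]
   Context: Paths are elements of $C[0,1]$ with Wiener measure (law of standard one-dimensional Brownian motion started at $0$), a computable probability space; Martin-Löf randomness is with respect to it. $x\upharpoonright n$ denotes the first $n$ bits of the binary expansion of $x$, and $K$ is prefix-free Kolmogorov complexity. *)

theory Defs
  imports "HOL-Probability.Probability" "HOL-Library.Nat_Bijection"
begin

section \<open>Partial recursive functions\<close>

datatype recf =
    Zero
  | Successor
  | Proj nat
  | Comp recf "recf list"
  | PrimRec recf recf
  | Mu recf

text \<open>
  \<open>computes f xs y\<close>: on arguments \<open>xs\<close> the term \<open>f\<close> terminates with value \<open>y\<close>. Terms carry no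
  arity; a term applied to too few arguments is undefined.
  In \<open>PrimRec f g\<close> the recursion argument comes first, and the step \<open>g\<close> gets the predecessor, the
  previous value and the parameters, in this order. \<open>Mu f\<close> searches for the least value of the
  first argument of \<open>f\<close>, and diverges if \<open>f\<close> does at a smaller value.
\<close>

inductive computes :: "recf \<Rightarrow> nat list \<Rightarrow> nat \<Rightarrow> bool" where
  Zero: "computes Zero xs 0"
| Successor: "computes Successor (x # xs) (Suc x)"
| Proj: "i < length xs \<Longrightarrow> computes (Proj i) xs (xs ! i)"
| Comp: "length ys = length gs \<Longrightarrow> (\<forall>i<length gs. computes (gs ! i) xs (ys ! i)) \<Longrightarrow>
    computes f ys z \<Longrightarrow> computes (Comp f gs) xs z"
| PrimRec_0: "computes f xs z \<Longrightarrow> computes (PrimRec f g) (0 # xs) z"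
| PrimRec_Suc: "computes (PrimRec f g) (n # xs) y \<Longrightarrow> computes g (n # y # xs) z \<Longrightarrow>
    computes (PrimRec f g) (Suc n # xs) z"
| Mu: "computes f (n # xs) 0 \<Longrightarrow> (\<forall>m<n. \<exists>y. computes f (m # xs) (Suc y)) \<Longrightarrow>
    computes (Mu f) xs n"

text \<open>A family of sets of naturals that is computably enumerable uniformly in \<open>n\<close>.\<close>

definition uniformly_ce :: "(nat \<Rightarrow> nat set) \<Rightarrow> bool" where
  "uniformly_ce A \<longleftrightarrow> (\<exists>f. \<forall>n k. k \<in> A n \<longleftrightarrow> (\<exists>y. computes f [n, k] y))"


section \<open>Prefix-free Kolmogorov complexity\<close>

text \<open>The string \<open>\<sigma>\<close> is coded by the number with binary representation \<open>1\<sigma>\<close>.\<close>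

definition str_code :: "bool list \<Rightarrow> nat" where
  "str_code \<sigma> = foldl (\<lambda>n b. 2 * n + of_bool b) 1 \<sigma>"

definition partial_computable_str :: "(bool list \<rightharpoonup> bool list) \<Rightarrow> bool" where
  "partial_computable_str M \<longleftrightarrow>
     (\<exists>f. \<forall>\<sigma> y. computes f [str_code \<sigma>] y \<longleftrightarrow> (\<exists>\<tau>. M \<sigma> = Some \<tau> \<and> y = str_code \<tau>))"

definition prefix_free_machine :: "(bool list \<rightharpoonup> bool list) \<Rightarrow> bool" where
  "prefix_free_machine M \<longleftrightarrow>
     partial_computable_str M \<and> (\<forall>\<sigma>\<in>dom M. \<forall>\<rho>. \<rho> \<noteq> [] \<longrightarrow> \<sigma> @ \<rho> \<notin> dom M)"

definition optimal_prefix_free_machine :: "(bool list \<rightharpoonup> bool list) \<Rightarrow> bool" where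
  "optimal_prefix_free_machine U \<longleftrightarrow>
     prefix_free_machine U \<and>
     (\<forall>M. prefix_free_machine M \<longrightarrow>
        (\<exists>c. \<forall>\<sigma> \<tau>. M \<sigma> = Some \<tau> \<longrightarrow> (\<exists>\<rho>. U \<rho> = Some \<tau> \<and> length \<rho> \<le> length \<sigma> + c)))"

text \<open>
  The complexity \<open>K(\<tau>)\<close> relative to the machine \<open>U\<close>. It is meaningful when \<open>\<tau>\<close> is in the range of \<open>U\<close>;
  an optimal machine is onto.
\<close>

definition prefix_complexity :: "(bool list \<rightharpoonup> bool list) \<Rightarrow> bool list \<Rightarrow> nat" where
  "prefix_complexity U \<tau> = (LEAST n. \<exists>\<sigma>. length \<sigma> = n \<and> U \<sigma> = Some \<tau>)"

text \<open>
  \<open>b\<close> is a binary expansion of \<open>x \<in> [0,1]\<close>. It is unique unless \<open>x\<close> is a dyadic rational in \<open>(0,1)\<close>,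
  and the expansion of \<open>1\<close> is \<open>0.111\<dots>\<close>.
\<close>

definition binary_expansion :: "real \<Rightarrow> (nat \<Rightarrow> bool) \<Rightarrow> bool" where
  "binary_expansion x b \<longleftrightarrow> (\<lambda>i. of_bool (b i) / 2 ^ Suc i) sums x"

definition initial_bits :: "(nat \<Rightarrow> bool) \<Rightarrow> nat \<Rightarrow> bool list" where
  "initial_bits b n = map b [0..<n]"


section \<open>Wiener measure on \<open>C[0,1]\<close>\<close>

text \<open>\<open>C[0,1]\<close> with the supremum metric; its elements are functions undefined outside \<open>{0..1}\<close>.\<close>

definition path_space :: "(real \<Rightarrow> real) metric" where
  "path_space = cfunspace (top_of_set {0..1}) euclidean_metric"

definition path_borel :: "(real \<Rightarrow> real) measure" where
  "path_borel = sigma (mspace path_space) {S. openin (mtopology_of path_space) S}"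

definition wiener_measure :: "(real \<Rightarrow> real) measure \<Rightarrow> bool" where
  "wiener_measure W \<longleftrightarrow>
     prob_space W \<and> space W = mspace path_space \<and> sets W = sets path_borel \<and>
     (AE B in W. B 0 = 0) \<and>
     (\<forall>s t. 0 \<le> s \<and> s < t \<and> t \<le> 1 \<longrightarrow>
        distributed W lborel (\<lambda>B. B t - B s) (normal_density 0 (sqrt (t - s)))) \<and>
     (\<forall>(t :: nat \<Rightarrow> real) n. (\<forall>i\<le>n. t i \<in> {0..1}) \<and> (\<forall>i<n. t i < t (Suc i)) \<longrightarrow>
        prob_space.indep_vars W (\<lambda>_. borel) (\<lambda>i B. B (t (Suc i)) - B (t i)) {..<n})"


section \<open>Martin-Loef randomness for paths\<close>

text \<open>
  The computable metric structure of \<open>C[0,1]\<close>: the ideal points are the rational polygonal paths. Every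
  such path is linear between the nodes \<open>i / m\<close>, for some \<open>m\<close>, and is given by the list of its values
  there, here as a combination of hat functions.
\<close>

definition polygonal_path :: "real list \<Rightarrow> real \<Rightarrow> real" where
  "polygonal_path qs =
     restrict (\<lambda>t. \<Sum>i<length qs. qs ! i * max 0 (1 - \<bar>real (length qs - 1) * t - real i\<bar>)) {0..1}"

definition rat_of_code :: "nat \<Rightarrow> real" where
  "rat_of_code n = (case prod_decode n of (a, b) \<Rightarrow> of_int (int_decode a) / of_nat (Suc b))"

definition ideal_path :: "nat \<Rightarrow> real \<Rightarrow> real" where
  "ideal_path k = polygonal_path (map rat_of_code (list_decode k))"

text \<open>Nonpositive radii are harmless: the ball is then empty.\<close>

definition ideal_ball :: "nat \<Rightarrow> (real \<Rightarrow> real) set" where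
  "ideal_ball k =
     (case prod_decode k of (i, j) \<Rightarrow> mball_of path_space (ideal_path i) (rat_of_code j))"

definition uniformly_effectively_open :: "(nat \<Rightarrow> (real \<Rightarrow> real) set) \<Rightarrow> bool" where
  "uniformly_effectively_open V \<longleftrightarrow>
     (\<exists>A. uniformly_ce A \<and> (\<forall>n. V n = (\<Union>k\<in>A n. ideal_ball k)))"

definition martin_loef_test :: "(real \<Rightarrow> real) measure \<Rightarrow> (nat \<Rightarrow> (real \<Rightarrow> real) set) \<Rightarrow> bool" where
  "martin_loef_test W V \<longleftrightarrow> uniformly_effectively_open V \<and> (\<forall>n. measure W (V n) \<le> 1 / 2 ^ n)"

definition martin_loef_random :: "(real \<Rightarrow> real) measure \<Rightarrow> (real \<Rightarrow> real) \<Rightarrow> bool" where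
  "martin_loef_random W B \<longleftrightarrow> B \<in> mspace path_space \<and> (\<forall>V. martin_loef_test W V \<longrightarrow> B \<notin> (\<Inter>n. V n))"

end

theory Submission
  imports Defs
begin

text \<open>
  For a string \<open>\<sigma>\<close> of length \<open>n\<close> let \<open>I(\<sigma>)\<close> be its dyadic interval and let \<open>\<epsilon> = 2 ^ -(n div 2)\<close>. A Brownian
  path takes a value in \<open>(-\<epsilon>, \<epsilon>)\<close> on \<open>I(\<sigma>)\<close> with probability at most a constant times \<open>\<epsilon>\<close>, as long as
  \<open>I(\<sigma>)\<close> ends after \<open>2 ^ -d\<close>: after the first small value, the increment up to the right end of \<open>I(\<sigma>)\<close> is
  independent and by Chebyshev smaller than \<open>2\<epsilon>\<close> with probability at least one half, so the value
  at the right end is below \<open>3\<epsilon>\<close>. Hence, by Kraft's inequality, the sum of \<open>2 ^ (|\<sigma>| div 2 - |\<rho>|)\<close> over all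
  programs \<open>\<rho>\<close> with an output \<open>\<sigma>\<close> on whose interval the path gets that small has finite expectation.
  Unlike the existence of a zero, the existence of a small value is an open condition, so the paths
  for which the sum exceeds \<open>2 ^ (m + d + 4)\<close> contain a Martin-Loef test that captures every path with a zero
  at \<open>x\<close> if the series of the theorem diverges.
\<close>

section \<open>Recursive functions and semidecidable relations\<close>

text \<open>A test has to be a union of ideal balls whose codes are enumerated by a
  \<open>recf\<close> term. Smallness of a path is therefore certified by the code of a ball alone:
  at a node of the centre, the absolute values of the centre and of the radius add up to less than
  \<epsilon>. One node serves for all prefixes of x at once: x lies in all their cells, and on a
  dyadic grid at least as fine as the cells the first grid point not left of x leaves none of them.

  The exponent n / 2 is Brownian scaling: a cell of length 2 ^ -n \<le> \<epsilon> ^ 2 allows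
  increments of standard deviation at most \<epsilon>. Rounding to n div 2 keeps the weights powers
  of 2 and costs a bounded factor. That x is positive enters through d: near time 0 a path started
  at 0 is small anyway, whereas for cells ending after 2 ^ -d the factor 1 / sqrt e of the density
  bound is at most 2 ^ d. The 4 in the threshold absorbs the constant 12 of \<open>hit_prob\<close>,
  the m is consumed by Markov's inequality.\<close>

inductive_cases computes_ZeroE: "computes Zero xs y"
inductive_cases computes_SuccessorE: "computes Successor xs y"
inductive_cases computes_ProjE: "computes (Proj i) xs y"
inductive_cases computes_CompE: "computes (Comp f gs) xs y"
inductive_cases computes_PrimRec_0E: "computes (PrimRec f g) (0 # xs) y"
inductive_cases computes_PrimRec_SucE: "computes (PrimRec f g) (Suc n # xs) y"
inductive_cases computes_PrimRecE: "computes (PrimRec f g) xs y"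
inductive_cases computes_MuE: "computes (Mu f) xs y"

text \<open>Needed to read a halting computation backwards: when a search by \<open>Mu\<close> has
  stopped at a value 0, this 0 must be the truth value that the term is known to yield.\<close>

lemma computes_deterministic: "computes f xs y \<Longrightarrow> computes f xs z \<Longrightarrow> y = z"
proof (induction arbitrary: z rule: computes.induct)
  case (Zero xs)
  then show ?case by (auto elim: computes_ZeroE)
next
  case (Successor x xs)
  then show ?case by (auto elim: computes_SuccessorE)
next
  case (Proj i xs)
  then show ?case by (auto elim: computes_ProjE)
next
  case (Comp ys gs xs f y)
  from Comp.prems obtain zs where zs: "length zs = length gs"
    "\<forall>i<length gs. computes (gs ! i) xs (zs ! i)" "computes f zs z"
    by (rule computes_CompE)
  have "ys = zs"
    using Comp.hyps(1) zs(1,2) Comp.IH(1) by (intro nth_equalityI) auto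
  then show ?case using Comp.IH zs(3) by blast
next
  case (PrimRec_0 f xs y g)
  show ?case using PrimRec_0.prems by (rule computes_PrimRec_0E) (rule PrimRec_0.IH)
next
  case (PrimRec_Suc f g n xs y w)
  show ?case
    using PrimRec_Suc.prems by (rule computes_PrimRec_SucE) (use PrimRec_Suc.IH in blast)
next
  case (Mu f n xs)
  from Mu.prems have z: "computes f (z # xs) 0" "\<forall>m<z. \<exists>y. computes f (m # xs) (Suc y)"
    by (auto elim: computes_MuE)
  show ?case
  proof (cases n z rule: linorder_cases)
    case less
    then show ?thesis using z(2) Mu.IH(1) by blast
  next
    case greater
    then obtain y where "\<And>v. computes f (z # xs) v \<Longrightarrow> Suc y = v"
      using Mu.IH(2) by blast
    then show ?thesis using z(1) by blast
  qed
qed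

text \<open>
  Functions of finitely many naturals are represented as functions of an environment
  \<open>e :: nat \<Rightarrow> nat\<close> that depend on a finite part of it only. A bound variable is put in front: it
  becomes \<open>e 0\<close>, and the old environment is \<open>\<lambda>i. e (Suc i)\<close>.
\<close>

definition recursive :: "((nat \<Rightarrow> nat) \<Rightarrow> nat) \<Rightarrow> bool" where
  "recursive F \<longleftrightarrow> (\<exists>f N. \<forall>m\<ge>N. \<forall>e. computes f (map e [0..<m]) (F e))"

lemma recursive_var: "recursive (\<lambda>e. e i)"
  unfolding recursive_def
proof (intro exI allI impI)
  fix m e assume "m \<ge> Suc i"
  then have "computes (Proj i) (map e [0..<m]) (map e [0..<m] ! i)"
    by (intro computes.Proj) auto
  then show "computes (Proj i) (map e [0..<m]) (e i)" using \<open>m \<ge> Suc i\<close> by simp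
qed

lemma recursive_bounded_family:
  assumes "\<And>i. i < (n :: nat) \<Longrightarrow> recursive (G i)"
  shows "\<exists>g N. \<forall>i<n. \<forall>m\<ge>N. \<forall>e. computes (g i) (map e [0..<m]) (G i e)"
proof -
  have "\<forall>i. \<exists>f N. i < n \<longrightarrow> (\<forall>m\<ge>N. \<forall>e. computes f (map e [0..<m]) (G i e))"
    using assms unfolding recursive_def by blast
  then obtain g M where "\<forall>i. i < n \<longrightarrow> (\<forall>m\<ge>M i. \<forall>e. computes (g i) (map e [0..<m]) (G i e))"
    by metis
  moreover have "\<forall>i. i < n \<longrightarrow> M i \<le> Max (M ` {..<n})" by auto
  ultimately show ?thesis by (intro exI[of _ g] exI[of _ "Max (M ` {..<n})"]) (meson order_trans)
qed

text \<open>A term for \<open>H\<close> can be run on finitely many coordinates, so only finitely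
  many members of the infinite family \<open>G\<close> enter the composed term, and one threshold
  works for all of these.\<close>

lemma recursive_subst:
  assumes "recursive H" and "\<And>i. recursive (G i)"
  shows "recursive (\<lambda>e. H (\<lambda>i. G i e))"
proof -
  obtain h n where h: "\<And>m e. n \<le> m \<Longrightarrow> computes h (map e [0..<m]) (H e)"
    using assms(1) unfolding recursive_def by blast
  obtain N g where g: "\<And>i m e. i < n \<Longrightarrow> N \<le> m \<Longrightarrow> computes (g i) (map e [0..<m]) (G i e)"
    using recursive_bounded_family[of n G, OF assms(2)] by metis
  have "computes (Comp h (map g [0..<n])) (map e [0..<m]) (H (\<lambda>i. G i e))" if "m \<ge> N" for m e
    by (rule computes.Comp[where ys = "map (\<lambda>i. G i e) [0..<n]"]) (auto intro!: h g that)
  then show ?thesis unfolding recursive_def by blast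
qed

lemma recursive_case_nat:
  "recursive F \<Longrightarrow> (\<And>j. recursive (G j)) \<Longrightarrow> recursive (\<lambda>e. case i of 0 \<Rightarrow> F e | Suc j \<Rightarrow> G j e)"
  by (cases i) auto

lemma recursive_fun1: "recursive (\<lambda>e. h (e 0)) \<Longrightarrow> recursive F \<Longrightarrow> recursive (\<lambda>e. h (F e))"
  using recursive_subst[of "\<lambda>e. h (e 0)" "\<lambda>_. F"] by simp

lemma recursive_fun2:
  "recursive (\<lambda>e. h (e 0) (e 1)) \<Longrightarrow> recursive F \<Longrightarrow> recursive G \<Longrightarrow> recursive (\<lambda>e. h (F e) (G e))"
  using recursive_subst[of "\<lambda>e. h (e 0) (e 1)" "\<lambda>i. if i = 0 then F else G"] by simp

lemma recursive_fun3:
  "recursive (\<lambda>e. h (e 0) (e 1) (e 2)) \<Longrightarrow> recursive F \<Longrightarrow> recursive G \<Longrightarrow> recursive H \<Longrightarrow>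
    recursive (\<lambda>e. h (F e) (G e) (H e))"
  using recursive_subst[of "\<lambda>e. h (e 0) (e 1) (e 2)"
      "\<lambda>i. if i = 0 then F else if i = 1 then G else H"] by simp

lemma recursive_Suc:
  assumes "recursive F"
  shows "recursive (\<lambda>e. Suc (F e))"
proof (rule recursive_fun1[OF _ assms])
  have "computes Successor (map e [0..<m]) (Suc (e 0))" if "m \<ge> 1" for m and e :: "nat \<Rightarrow> nat"
    using that by (simp add: upt_conv_Cons computes.Successor)
  then show "recursive (\<lambda>e. Suc (e 0))" unfolding recursive_def by blast
qed

lemma recursive_const: "recursive (\<lambda>_. c)"
proof (induction c)
  case 0
  show ?case unfolding recursive_def by (auto intro: computes.Zero)
next
  case (Suc c)
  then show ?case by (rule recursive_Suc)
qed

lemma env_Cons: "x # map e [0..<m] = map (case_nat x e) [0..<Suc m]"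
proof -
  have "map (case_nat x e) [0..<Suc m] = case_nat x e 0 # map (case_nat x e) (map Suc [0..<m])"
    by (simp only: upt_conv_Cons[OF zero_less_Suc] list.map map_Suc_upt)
  then show ?thesis by (simp add: comp_def)
qed

lemma computes_PrimRec_rec_nat:
  assumes "computes f xs a" and "\<And>i y. computes g (i # y # xs) (b i y)"
  shows "computes (PrimRec f g) (n # xs) (rec_nat a b n)"
proof (induction n)
  case 0
  show ?case using assms(1) by (simp add: computes.PrimRec_0)
next
  case (Suc n)
  show ?case using computes.PrimRec_Suc[OF Suc assms(2)] by simp
qed

text \<open>\<open>PrimRec\<close> recurses on its first argument. The term is built for a counter
  in front of the environment, and \<open>N\<close> is substituted for the counter at the
  end.\<close>

lemma recursive_rec_nat:
  assumes "recursive F" and "recursive (\<lambda>e. G (e 0) (e 1) (\<lambda>i. e (Suc (Suc i))))" and "recursive N"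
  shows "recursive (\<lambda>e. rec_nat (F e) (\<lambda>i y. G i y e) (N e))"
proof -
  let ?R = "\<lambda>e :: nat \<Rightarrow> nat. rec_nat (F (\<lambda>i. e (Suc i))) (\<lambda>i y. G i y (\<lambda>i. e (Suc i))) (e 0)"
  obtain f n1 where f: "\<And>m e. n1 \<le> m \<Longrightarrow> computes f (map e [0..<m]) (F e)"
    using assms(1) unfolding recursive_def by blast
  obtain g n2 where g: "\<And>m e. n2 \<le> m \<Longrightarrow>
      computes g (map e [0..<m]) (G (e 0) (e 1) (\<lambda>i. e (Suc (Suc i))))"
    using assms(2) unfolding recursive_def by blast
  have "computes (PrimRec f g) (map e [0..<m]) (?R e)" if m: "m \<ge> Suc (n1 + n2)" for m e
  proof -
    obtain m' where m': "m = Suc m'" "m' \<ge> n1" "m' \<ge> n2" using m by (cases m) auto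
    have e: "map e [0..<m] = e 0 # map (\<lambda>i. e (Suc i)) [0..<m']"
      unfolding env_Cons m'(1) by (auto split: nat.split)
    have "computes g (i # y # map (\<lambda>i. e (Suc i)) [0..<m']) (G i y (\<lambda>i. e (Suc i)))" for i y
      unfolding env_Cons using g[of "Suc (Suc m')" "case_nat i (case_nat y (\<lambda>i. e (Suc i)))"] m'
      by simp
    then show ?thesis unfolding e using f m'(2) by (intro computes_PrimRec_rec_nat)
  qed
  then have "recursive ?R" unfolding recursive_def by blast
  moreover have "recursive (case i of 0 \<Rightarrow> N | Suc j \<Rightarrow> (\<lambda>e. e j))" for i
    using assms(3) recursive_var by (cases i) auto
  ultimately have "recursive (\<lambda>e. ?R (\<lambda>i. (case i of 0 \<Rightarrow> N | Suc j \<Rightarrow> (\<lambda>e. e j)) e))"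
    by (rule recursive_subst)
  then show ?thesis by simp
qed

lemma recursive_least:
  assumes "recursive (\<lambda>e. Q (e 0) (\<lambda>i. e (Suc i)))" and "\<And>e. \<exists>y. Q y e = 0"
  shows "recursive (\<lambda>e. LEAST y. Q y e = 0)"
proof -
  obtain q n where q: "\<And>m e. n \<le> m \<Longrightarrow> computes q (map e [0..<m]) (Q (e 0) (\<lambda>i. e (Suc i)))"
    using assms(1) unfolding recursive_def by blast
  have "computes (Mu q) (map e [0..<m]) (LEAST y. Q y e = 0)" if m: "m \<ge> n" for m e
  proof -
    have Q: "computes q (y # map e [0..<m]) (Q y e)" for y
      unfolding env_Cons using q[of "Suc m" "case_nat y e"] m by simp
    have "Q (LEAST y. Q y e = 0) e = 0" using assms(2) by (rule LeastI_ex)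
    then have "computes q ((LEAST y. Q y e = 0) # map e [0..<m]) 0" using Q by metis
    moreover have "\<exists>v. computes q (y # map e [0..<m]) (Suc v)" if "y < (LEAST y. Q y e = 0)" for y
      using Q[of y] not_less_Least[OF that] by (metis not0_implies_Suc)
    ultimately show ?thesis by (intro computes.Mu) auto
  qed
  then show ?thesis unfolding recursive_def by blast
qed

section \<open>Arithmetic, bounded quantifiers and decidable relations\<close>

lemma recursive_add: "recursive F \<Longrightarrow> recursive G \<Longrightarrow> recursive (\<lambda>e. F e + G e)"
proof -
  assume "recursive F" "recursive G"
  then have "recursive (\<lambda>e. rec_nat (F e) (\<lambda>i y. Suc y) (G e))"
    by (intro recursive_rec_nat recursive_Suc recursive_var)
  moreover have "rec_nat a (\<lambda>i y. Suc y) b = a + b" for a b by (induction b) auto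
  ultimately show ?thesis by simp
qed

lemma recursive_mult: "recursive F \<Longrightarrow> recursive G \<Longrightarrow> recursive (\<lambda>e. F e * G e)"
proof (rule recursive_fun2[of "(*)"])
  have "recursive (\<lambda>e. rec_nat 0 (\<lambda>i y. y + e 0) (e 1))"
    by (intro recursive_rec_nat recursive_add recursive_const recursive_var)
  moreover have "rec_nat 0 (\<lambda>i y. y + a) b = a * b" for a b :: nat by (induction b) auto
  ultimately show "recursive (\<lambda>e. e 0 * e 1)" by simp
qed

lemma recursive_diff: "recursive F \<Longrightarrow> recursive G \<Longrightarrow> recursive (\<lambda>e. F e - G e)"
proof (rule recursive_fun2[of "(-)"])
  have "rec_nat 0 (\<lambda>i y. i) b = b - 1" for b :: nat by (induction b) auto
  moreover have "recursive (\<lambda>e. rec_nat 0 (\<lambda>i y. i) (e 0))"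
    by (intro recursive_rec_nat recursive_const recursive_var)
  ultimately have pred: "recursive (\<lambda>e. e 0 - 1)" by simp
  have "recursive (\<lambda>e. rec_nat (e 0) (\<lambda>i y. y - 1) (e 1))"
    by (intro recursive_rec_nat recursive_fun1[OF pred] recursive_var)
  moreover have "rec_nat a (\<lambda>i y. y - 1) b = a - b" for a b :: nat by (induction b) auto
  ultimately show "recursive (\<lambda>e. e 0 - e 1)" by simp
qed

lemma recursive_power: "recursive F \<Longrightarrow> recursive G \<Longrightarrow> recursive (\<lambda>e. F e ^ G e)"
proof (rule recursive_fun2[of "(^)"])
  have "recursive (\<lambda>e. rec_nat 1 (\<lambda>i y. e 0 * y) (e 1))"
    by (intro recursive_rec_nat recursive_mult recursive_const recursive_var)
  moreover have "rec_nat 1 (\<lambda>i y. a * y) b = a ^ b" for a b :: nat by (induction b) auto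
  ultimately show "recursive (\<lambda>e. e 0 ^ e 1)" by simp
qed

lemma recursive_sum:
  assumes "recursive (\<lambda>e. F (e 0) (\<lambda>i. e (Suc i)))" and "recursive N"
  shows "recursive (\<lambda>e. \<Sum>i<N e. F i e)"
proof -
  have "recursive (\<lambda>e. F (e 0) (\<lambda>i. e (Suc (Suc i))))"
    using recursive_subst[OF assms(1), of "\<lambda>i e. e (if i = 0 then 0 else Suc i)"]
    by (simp add: recursive_var)
  then have "recursive (\<lambda>e. rec_nat 0 (\<lambda>i y. y + F i e) (N e))"
    by (intro recursive_rec_nat recursive_add recursive_const recursive_var assms)
  moreover have "rec_nat 0 (\<lambda>i y. y + F i e) n = (\<Sum>i<n. F i e)" for n e
    by (induction n) auto
  ultimately show ?thesis by simp
qed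

definition decidable :: "((nat \<Rightarrow> nat) \<Rightarrow> bool) \<Rightarrow> bool" where
  "decidable P \<longleftrightarrow> recursive (\<lambda>e. of_bool (P e))"

lemma decidable_subst:
  "decidable P \<Longrightarrow> (\<And>i. recursive (G i)) \<Longrightarrow> decidable (\<lambda>e. P (\<lambda>i. G i e))"
  unfolding decidable_def by (rule recursive_subst)

lemma decidable_not: "decidable P \<Longrightarrow> decidable (\<lambda>e. \<not> P e)"
proof -
  assume "decidable P"
  then have "recursive (\<lambda>e. 1 - of_bool (P e))"
    unfolding decidable_def by (intro recursive_diff recursive_const)
  moreover have "(1 - of_bool (P e) :: nat) = of_bool (\<not> P e)" for e by simp
  ultimately show ?thesis unfolding decidable_def by simp
qed

lemma decidable_conj: "decidable P \<Longrightarrow> decidable Q \<Longrightarrow> decidable (\<lambda>e. P e \<and> Q e)"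
  unfolding decidable_def of_bool_conj by (rule recursive_mult)

lemma decidable_le: "recursive F \<Longrightarrow> recursive G \<Longrightarrow> decidable (\<lambda>e. F e \<le> G e)"
proof -
  assume "recursive F" "recursive G"
  then have "recursive (\<lambda>e. 1 - (F e - G e))"
    by (intro recursive_diff recursive_const)
  moreover have "1 - (F e - G e) = of_bool (F e \<le> G e)" for e by simp
  ultimately show ?thesis unfolding decidable_def by simp
qed

lemma decidable_less: "recursive F \<Longrightarrow> recursive G \<Longrightarrow> decidable (\<lambda>e. F e < G e)"
  using decidable_le[of "\<lambda>e. Suc (F e)" G] by (simp add: Suc_le_eq recursive_Suc)

lemma decidable_eq: "recursive F \<Longrightarrow> recursive G \<Longrightarrow> decidable (\<lambda>e. F e = G e)"
  using decidable_conj[OF decidable_le[of F G] decidable_le[of G F]] by (simp add: eq_iff)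

lemma decidable_bex:
  assumes "decidable (\<lambda>e. P (e 0) (\<lambda>i. e (Suc i)))" and "recursive N"
  shows "decidable (\<lambda>e. \<exists>i<N e. P i e)"
proof -
  have "recursive (\<lambda>e. \<Sum>i<N e. of_bool (P i e))"
    using assms unfolding decidable_def by (rule recursive_sum)
  then have "decidable (\<lambda>e. 0 < (\<Sum>i<N e. of_bool (P i e) :: nat))"
    by (intro decidable_less recursive_const)
  moreover have "0 < (\<Sum>i<N e. of_bool (P i e) :: nat) \<longleftrightarrow> (\<exists>i<N e. P i e)" for e
    by (subst zero_less_iff_neq_zero) auto
  ultimately show ?thesis by simp
qed

lemma decidable_ball:
  assumes "decidable (\<lambda>e. P (e 0) (\<lambda>i. e (Suc i)))" and "recursive N"
  shows "decidable (\<lambda>e. \<forall>i<N e. P i e)"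
  using decidable_not[OF decidable_bex[OF decidable_not[OF assms(1)] assms(2)]] by simp

text \<open>The value is found by unbounded search, which terminates because \<open>F\<close> is
  total. Halving and the inverses of pairing are obtained in this way, since their graphs are
  described by simple arithmetic and bounded quantifiers.\<close>

lemma recursive_graph:
  assumes "decidable (\<lambda>e. e 0 = F (\<lambda>i. e (Suc i)))"
  shows "recursive F"
proof -
  have "recursive (\<lambda>e. of_bool (e 0 \<noteq> F (\<lambda>i. e (Suc i))))"
    using decidable_not[OF assms] unfolding decidable_def .
  then have "recursive (\<lambda>e. LEAST y. of_bool (y \<noteq> F e) = (0 :: nat))"
    by (rule recursive_least) auto
  moreover have "(LEAST y. y = F e) = F e" for e by (rule Least_equality) auto
  ultimately show ?thesis by simp
qed

lemmas recursive_intros = recursive_var recursive_const recursive_Suc recursive_add recursive_mult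
  recursive_diff recursive_power recursive_sum decidable_not decidable_conj decidable_le
  decidable_less decidable_eq decidable_bex decidable_ball

lemma recursive_div2: "recursive F \<Longrightarrow> recursive (\<lambda>e. F e div 2)"
proof (rule recursive_fun1[of "\<lambda>x. x div 2"], rule recursive_graph)
  have "decidable (\<lambda>e. 2 * e 0 \<le> e 1 \<and> e 1 < 2 * e 0 + 2)"
    by (intro recursive_intros)
  moreover have "y = x div 2 \<longleftrightarrow> 2 * y \<le> x \<and> x < 2 * y + 2" for x y :: nat by auto
  ultimately show "decidable (\<lambda>e. e 0 = e (Suc 0) div 2)" by simp
qed

lemma recursive_prod_encode:
  assumes "recursive F" "recursive G"
  shows "recursive (\<lambda>e. prod_encode (F e, G e))"
  unfolding prod_encode_def triangle_def
  by simp (intro recursive_intros recursive_div2 assms)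

text \<open>Both components of a pair are at most its code, so a bounded quantifier suffices in the
  graph of either projection.\<close>

lemma recursive_prod_decode:
  assumes "recursive F"
  shows "recursive (\<lambda>e. fst (prod_decode (F e)))" "recursive (\<lambda>e. snd (prod_decode (F e)))"
proof -
  have "decidable (\<lambda>e. \<exists>b<Suc (e 1). prod_encode (e 0, b) = e 1)"
    by (intro recursive_intros recursive_prod_encode)
  moreover have "(\<exists>b<Suc n. prod_encode (a, b) = n) \<longleftrightarrow> a = fst (prod_decode n)" for a n
    by (metis fst_conv le_imp_less_Suc le_prod_encode_2 prod.collapse prod_decode_inverse prod_encode_inverse)
  ultimately show "recursive (\<lambda>e. fst (prod_decode (F e)))"
    by (intro recursive_fun1[of "\<lambda>n. fst (prod_decode n)", OF recursive_graph assms]) simp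
  have "decidable (\<lambda>e. \<exists>a<Suc (e 1). prod_encode (a, e 0) = e 1)"
    by (intro recursive_intros recursive_prod_encode)
  moreover have "(\<exists>a<Suc n. prod_encode (a, b) = n) \<longleftrightarrow> b = snd (prod_decode n)" for b n
    by (metis snd_conv le_imp_less_Suc le_prod_encode_1 prod.collapse prod_decode_inverse prod_encode_inverse)
  ultimately show "recursive (\<lambda>e. snd (prod_decode (F e)))"
    by (intro recursive_fun1[of "\<lambda>n. snd (prod_decode n)", OF recursive_graph assms]) simp
qed

text \<open>In \<open>list_encode\<close> the code of x # xs is the successor of the code of a pair,
  namely of x and the code of xs; hence the \<open>y - 1\<close>. The code 0 of the empty list is
  mapped to itself.\<close>

definition code_drop :: "nat \<Rightarrow> nat \<Rightarrow> nat" where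
  "code_drop i c = rec_nat c (\<lambda>_ y. snd (prod_decode (y - 1))) i"

definition code_nth :: "nat \<Rightarrow> nat \<Rightarrow> nat" where
  "code_nth c i = fst (prod_decode (code_drop i c - 1))"

lemma recursive_code_drop: "recursive F \<Longrightarrow> recursive G \<Longrightarrow> recursive (\<lambda>e. code_drop (F e) (G e))"
  unfolding code_drop_def by (intro recursive_rec_nat recursive_prod_decode recursive_intros)

lemma recursive_code_nth: "recursive F \<Longrightarrow> recursive G \<Longrightarrow> recursive (\<lambda>e. code_nth (F e) (G e))"
  unfolding code_nth_def by (intro recursive_code_drop recursive_prod_decode recursive_intros)

lemma code_drop_list_encode: "code_drop i (list_encode l) = list_encode (drop i l)"
proof (induction i)
  case 0
  then show ?case by (simp add: code_drop_def)
next
  case (Suc i)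
  have "snd (prod_decode (list_encode l - 1)) = list_encode (tl l)" for l
  proof (cases l)
    case Nil
    have "prod_decode 0 = (0, 0)" by (simp add: prod_decode_def prod_decode_aux.simps)
    then show ?thesis using Nil by simp
  qed simp
  with Suc show ?case by (simp add: code_drop_def tl_drop drop_Suc)
qed

lemma code_nth_list_encode: "i < length l \<Longrightarrow> code_nth (list_encode l) i = l ! i"
  by (simp add: code_nth_def code_drop_list_encode Cons_nth_drop_Suc[symmetric])

lemma list_encode_eq_0_iff: "list_encode l = 0 \<longleftrightarrow> l = []"
  by (cases l) auto


text \<open>Expresses the length through \<open>code_drop\<close>, which is recursive, so that the
  number of nodes of a polygonal path can be decided from its code.\<close>

lemma length_list_decode_iff:
  "length (list_decode c) = Suc n \<longleftrightarrow> \<not> code_drop n c = 0 \<and> code_drop (Suc n) c = 0"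
  using code_drop_list_encode[of n "list_decode c"] code_drop_list_encode[of "Suc n" "list_decode c"]
  by (auto simp: list_encode_eq_0_iff)

section \<open>Semidecidable relations as projections of decidable ones\<close>

definition semidecidable :: "((nat \<Rightarrow> nat) \<Rightarrow> bool) \<Rightarrow> bool" where
  "semidecidable P \<longleftrightarrow>
     (\<exists>Q. decidable (\<lambda>e. Q (e 0) (\<lambda>i. e (Suc i))) \<and> (\<forall>e. P e \<longleftrightarrow> (\<exists>s. Q s e)))"

lemma semidecidable_decidable: "decidable P \<Longrightarrow> semidecidable P"
  unfolding semidecidable_def
  by (rule exI[of _ "\<lambda>_. P"]) (auto intro: decidable_subst recursive_var)

text \<open>Two unbounded quantifiers merge into one over pairs: the new witness codes
  \<open>x\<close> together with the witness for \<open>P x\<close>.\<close>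

lemma semidecidable_ex:
  assumes "semidecidable (\<lambda>e. P (e 0) (\<lambda>i. e (Suc i)))"
  shows "semidecidable (\<lambda>e. \<exists>x. P x e)"
proof -
  obtain Q where Q: "decidable (\<lambda>e. Q (e 0) (\<lambda>i. e (Suc i)))"
    "\<And>e. P (e 0) (\<lambda>i. e (Suc i)) \<longleftrightarrow> (\<exists>s. Q s e)"
    using assms unfolding semidecidable_def by blast
  have P: "P x e \<longleftrightarrow> (\<exists>s. Q s (case_nat x e))" for x e
    using Q(2)[of "case_nat x e"] by simp
  let ?G = "\<lambda>i e. case i of 0 \<Rightarrow> snd (prod_decode (e 0))
    | Suc j \<Rightarrow> (case j of 0 \<Rightarrow> fst (prod_decode (e 0)) | Suc k \<Rightarrow> e (Suc k))"
  have "recursive (?G i)" for i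
    by (intro recursive_case_nat recursive_var recursive_prod_decode)
  from decidable_subst[OF Q(1), of ?G, OF this]
  have "decidable (\<lambda>e. Q (snd (prod_decode (e 0)))
      (case_nat (fst (prod_decode (e 0))) (\<lambda>k. e (Suc k))))" by simp
  moreover have "(\<exists>x. P x e) \<longleftrightarrow>
      (\<exists>p. Q (snd (prod_decode p)) (case_nat (fst (prod_decode p)) e))" for e
    unfolding P by (metis fst_conv snd_conv prod_encode_inverse)
  ultimately show ?thesis unfolding semidecidable_def by (intro exI conjI allI)
qed

lemma semidecidable_conj:
  assumes "semidecidable P" and "semidecidable P'"
  shows "semidecidable (\<lambda>e. P e \<and> P' e)"
proof -
  obtain Q where Q: "decidable (\<lambda>e. Q (e 0) (\<lambda>i. e (Suc i)))" "\<And>e. P e \<longleftrightarrow> (\<exists>s. Q s e)"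
    using assms(1) unfolding semidecidable_def by blast
  obtain Q' where Q': "decidable (\<lambda>e. Q' (e 0) (\<lambda>i. e (Suc i)))" "\<And>e. P' e \<longleftrightarrow> (\<exists>s. Q' s e)"
    using assms(2) unfolding semidecidable_def by blast
  have "decidable (\<lambda>e. Q (e (if i = 0 then 1 else 0)) (\<lambda>i. e (Suc (Suc i))))" for i :: nat
    using decidable_subst[OF Q(1), of "\<lambda>j e. e (if j = 0 then if i = 0 then 1 else 0 else Suc j)"]
    by (simp add: recursive_var cong: if_cong)
  from this[of 0] have 1: "decidable (\<lambda>e. Q (e 1) (\<lambda>i. e (Suc (Suc i))))" by simp
  have 2: "decidable (\<lambda>e. Q' (e 0) (\<lambda>i. e (Suc (Suc i))))"
    using decidable_subst[OF Q'(1), of "\<lambda>j e. e (if j = 0 then 0 else Suc j)"]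
    by (simp add: recursive_var)
  have "semidecidable (\<lambda>e. \<exists>s t. Q s e \<and> Q' t e)"
    using decidable_conj[OF 1 2]
    by (intro semidecidable_ex semidecidable_decidable) simp
  then show ?thesis using Q(2) Q'(2) by simp
qed

text \<open>Collection: finitely many witnesses have a common bound, so the unbounded quantifier
  moves in front of the bounded one and leaves a decidable matrix.\<close>

lemma semidecidable_ball:
  assumes "semidecidable (\<lambda>e. P (e 0) (\<lambda>i. e (Suc i)))" and "recursive N"
  shows "semidecidable (\<lambda>e. \<forall>i<N e. P i e)"
proof -
  obtain Q where Q: "decidable (\<lambda>e. Q (e 0) (\<lambda>i. e (Suc i)))"
    "\<And>e. P (e 0) (\<lambda>i. e (Suc i)) \<longleftrightarrow> (\<exists>s. Q s e)"
    using assms(1) unfolding semidecidable_def by blast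
  have P: "P x e \<longleftrightarrow> (\<exists>s. Q s (case_nat x e))" for x e
    using Q(2)[of "case_nat x e"] by simp
  have collect: "(\<forall>i<n. P i e) \<longleftrightarrow> (\<exists>b. \<forall>i<n. \<exists>s<b. Q s (case_nat i e))" for n e
  proof
    assume "\<forall>i<n. P i e"
    then obtain s where s: "\<And>i. i < n \<Longrightarrow> Q (s i) (case_nat i e)" unfolding P by metis
    have "s i < Suc (Max (s ` {..<n}))" if "i < n" for i
      using that by (simp add: le_imp_less_Suc)
    then show "\<exists>b. \<forall>i<n. \<exists>s<b. Q s (case_nat i e)" using s by blast
  qed (auto simp: P)
  let ?G = "\<lambda>i e. case i of 0 \<Rightarrow> e 0
    | Suc j \<Rightarrow> (case j of 0 \<Rightarrow> e (Suc 0) | Suc k \<Rightarrow> e (Suc (Suc (Suc k))))"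
  have "recursive (?G i)" for i by (intro recursive_case_nat recursive_var)
  from decidable_subst[OF Q(1), of ?G, OF this]
  have d: "decidable (\<lambda>e. Q (e 0) (case_nat (e (Suc 0)) (\<lambda>k. e (Suc (Suc (Suc k))))))" by simp
  have N: "recursive (\<lambda>e. N (\<lambda>i. e (Suc i)))"
    by (rule recursive_subst[OF assms(2) recursive_var])
  have "semidecidable (\<lambda>e. \<exists>b. \<forall>i<N e. \<exists>s<b. Q s (case_nat i e))"
    using d N
    by (intro semidecidable_ex semidecidable_decidable decidable_ball decidable_bex recursive_var) simp
  then show ?thesis by (simp add: collect)
qed

text \<open>Here \<open>n\<close> is fixed and nothing uniform in \<open>i\<close> is assumed. This
  is the form for the argument terms of \<open>Comp\<close>, which are syntax and not
  numbers.\<close>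

lemma semidecidable_ball_const:
  assumes "\<And>i. i < (n :: nat) \<Longrightarrow> semidecidable (P i)"
  shows "semidecidable (\<lambda>e. \<forall>i<n. P i e)"
  using assms
proof (induction n)
  case 0
  have "decidable (\<lambda>_. (0 :: nat) = 0)" by (intro recursive_intros)
  then show ?case by (intro semidecidable_decidable) simp
next
  case (Suc n)
  then have "semidecidable (\<lambda>e. (\<forall>i<n. P i e) \<and> P n e)" by (intro semidecidable_conj) auto
  moreover have "(\<forall>i<Suc n. P i e) \<longleftrightarrow> (\<forall>i<n. P i e) \<and> P n e" for e
    by (auto simp: less_Suc_eq)
  ultimately show ?case by simp
qed

text \<open>Induction on the term takes the place of an interpreter that counts steps: each
  constructor turns into existential quantifiers over codes of intermediate values and bounded
  quantifiers over their positions.\<close>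

lemma semidecidable_computes:
  "(\<And>i. recursive (X i)) \<Longrightarrow> recursive Y \<Longrightarrow>
    semidecidable (\<lambda>e. computes f (map (\<lambda>i. X i e) [0..<n]) (Y e))"
proof (induction f arbitrary: n X Y)
  case Zero
  have "semidecidable (\<lambda>e. Y e = 0)"
    by (intro semidecidable_decidable recursive_intros Zero)
  moreover have "computes Zero xs y \<longleftrightarrow> y = 0" for xs y
    by (auto intro: computes.Zero elim: computes_ZeroE)
  ultimately show ?case by simp
next
  case Successor
  have "semidecidable (\<lambda>e. Y e = Suc (X 0 e) \<and> 0 < n)"
    by (intro semidecidable_decidable recursive_intros Successor)
  moreover have "computes Successor (map (\<lambda>i. X i e) [0..<n]) (Y e) \<longleftrightarrow> Y e = Suc (X 0 e) \<and> 0 < n" for e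
    by (cases n) (auto simp: upt_conv_Cons intro: computes.Successor elim: computes_SuccessorE simp del: upt_Suc)
  ultimately show ?case by simp
next
  case (Proj k)
  have "semidecidable (\<lambda>e. Y e = X k e \<and> k < n)"
    by (intro semidecidable_decidable recursive_intros Proj)
  moreover have "computes (Proj k) xs y \<longleftrightarrow> k < length xs \<and> y = xs ! k" for xs y
    by (auto intro: computes.Proj elim: computes_ProjE)
  ultimately show ?case by (simp add: conj_commute cong: conj_cong)
next
  case (Comp f gs)
  let ?m = "length gs"
  have eq: "computes (Comp f gs) xs y \<longleftrightarrow>
    (\<exists>c. (\<forall>i<?m. computes (gs ! i) xs (code_nth c i)) \<and>
      computes f (map (\<lambda>i. code_nth c i) [0..<?m]) y)" for xs y
  proof
    assume "computes (Comp f gs) xs y"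
    then obtain ys where "length ys = ?m" "\<forall>i<?m. computes (gs ! i) xs (ys ! i)" "computes f ys y"
      by (rule computes_CompE)
    moreover from this have "map (\<lambda>i. code_nth (list_encode ys) i) [0..<?m] = ys"
      by (intro nth_equalityI) (auto simp: code_nth_list_encode)
    ultimately show "\<exists>c. (\<forall>i<?m. computes (gs ! i) xs (code_nth c i)) \<and>
        computes f (map (\<lambda>i. code_nth c i) [0..<?m]) y"
      by (intro exI[of _ "list_encode ys"]) (auto simp: code_nth_list_encode)
  next
    assume "\<exists>c. (\<forall>i<?m. computes (gs ! i) xs (code_nth c i)) \<and>
        computes f (map (\<lambda>i. code_nth c i) [0..<?m]) y"
    then obtain c where "\<forall>i<?m. computes (gs ! i) xs (code_nth c i)"
      "computes f (map (\<lambda>i. code_nth c i) [0..<?m]) y" by blast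
    then show "computes (Comp f gs) xs y"
      by (intro computes.Comp[where ys = "map (\<lambda>i. code_nth c i) [0..<?m]"]) auto
  qed
  show ?case unfolding eq
    by (intro semidecidable_ex semidecidable_conj semidecidable_ball_const Comp.IH
        recursive_code_nth recursive_intros nth_mem recursive_subst[OF Comp.prems(1)]
        recursive_subst[OF Comp.prems(2)])
next
  case (PrimRec f g)
  \<comment> \<open>\<open>c\<close> codes the course of values of the recursion at 0, ..., k. Any
    number may serve as \<open>c\<close>, as \<open>code_nth\<close> is total.\<close>
  have eq: "computes (PrimRec f g) (k # xs) y \<longleftrightarrow>
    (\<exists>c. computes f xs (code_nth c 0) \<and>
      (\<forall>i<k. computes g (i # code_nth c i # xs) (code_nth c (Suc i))) \<and> code_nth c k = y)"
    (is "_ \<longleftrightarrow> ?R k y") for k xs y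
  proof
    assume "computes (PrimRec f g) (k # xs) y"
    then have "\<exists>l. length l = Suc k \<and> computes f xs (l ! 0) \<and>
        (\<forall>i<k. computes g (i # l ! i # xs) (l ! Suc i)) \<and> l ! k = y"
    proof (induction k arbitrary: y)
      case 0
      then show ?case by (intro exI[of _ "[y]"]) (auto elim: computes_PrimRec_0E)
    next
      case (Suc k)
      from Suc.prems obtain z where z: "computes (PrimRec f g) (k # xs) z" "computes g (k # z # xs) y"
        by (rule computes_PrimRec_SucE)
      from Suc.IH[OF z(1)] obtain l where "length l = Suc k" "computes f xs (l ! 0)"
        "\<forall>i<k. computes g (i # l ! i # xs) (l ! Suc i)" "l ! k = z" by blast
      with z(2) show ?case
        by (intro exI[of _ "l @ [y]"]) (auto simp: nth_append less_Suc_eq)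
    qed
    then obtain l where "length l = Suc k" "computes f xs (l ! 0)"
        "\<forall>i<k. computes g (i # l ! i # xs) (l ! Suc i)" "l ! k = y" by blast
    then show "?R k y"
      by (intro exI[of _ "list_encode l"]) (auto simp: code_nth_list_encode)
  next
    assume "?R k y"
    then obtain c where c: "computes f xs (code_nth c 0)"
      "\<forall>i<k. computes g (i # code_nth c i # xs) (code_nth c (Suc i))" "code_nth c k = y" by blast
    have "j \<le> k \<Longrightarrow> computes (PrimRec f g) (j # xs) (code_nth c j)" for j
      by (induction j) (use c(1,2) in \<open>auto intro: computes.intros\<close>)
    then show "computes (PrimRec f g) (k # xs) y" using c(3) by blast
  qed
  show ?case
  proof (cases n)
    case 0
    have "decidable (\<lambda>_. (0 :: nat) < 0)" by (intro recursive_intros)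
    moreover have "\<not> computes (PrimRec f g) [] y" for y by (auto elim: computes_PrimRecE)
    ultimately show ?thesis using 0 semidecidable_decidable by simp
  next
    case (Suc n')
    have xs: "map (\<lambda>i. X i e) [0..<n] = X 0 e # map (\<lambda>i. X (Suc i) e) [0..<n']" for e
      unfolding Suc env_Cons by (auto split: nat.split)
    have xs': "a # b # map (\<lambda>i. X (Suc i) e) [0..<n'] =
       map (\<lambda>i. case i of 0 \<Rightarrow> a | Suc j \<Rightarrow> (case j of 0 \<Rightarrow> b | Suc k \<Rightarrow> X (Suc k) e)) [0..<Suc (Suc n')]"
      for a b e unfolding env_Cons ..
    have 1: "semidecidable (\<lambda>e. computes f (map (\<lambda>i. X (Suc i) (\<lambda>i. e (Suc i))) [0..<n']) (code_nth (e 0) 0))"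
      by (intro PrimRec.IH(1) recursive_code_nth recursive_intros recursive_subst[OF PrimRec.prems(1)])
    have 2: "semidecidable (\<lambda>e. computes g (e 0 # code_nth (e 1) (e 0) #
        map (\<lambda>i. X (Suc i) (\<lambda>i. e (Suc (Suc i)))) [0..<n']) (code_nth (e 1) (Suc (e 0))))"
      unfolding xs'
    proof (rule PrimRec.IH(2))
      show "recursive (\<lambda>e. case i of 0 \<Rightarrow> e 0 | Suc j \<Rightarrow> (case j of 0 \<Rightarrow> code_nth (e 1) (e 0)
          | Suc k \<Rightarrow> X (Suc k) (\<lambda>i. e (Suc (Suc i)))))" for i
        by (intro recursive_case_nat recursive_var recursive_code_nth recursive_subst[OF PrimRec.prems(1)])
    qed (intro recursive_intros recursive_code_nth)
    show ?thesis unfolding xs eq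
    proof (intro semidecidable_ex semidecidable_conj 1 semidecidable_ball)
      show "semidecidable (\<lambda>e. computes g (e 0 # code_nth (e (Suc 0)) (e 0) #
          map (\<lambda>i. X (Suc i) (\<lambda>i. e (Suc (Suc i)))) [0..<n']) (code_nth (e (Suc 0)) (Suc (e 0))))"
        using 2 by simp
      show "recursive (\<lambda>e. X 0 (\<lambda>i. e (Suc i)))"
        by (rule recursive_subst[OF PrimRec.prems(1) recursive_var])
      show "semidecidable (\<lambda>e. code_nth (e 0) (X 0 (\<lambda>i. e (Suc i))) = Y (\<lambda>i. e (Suc i)))"
        by (intro semidecidable_decidable recursive_intros recursive_code_nth
            recursive_subst[OF PrimRec.prems(1)] recursive_subst[OF PrimRec.prems(2)])
    qed
  qed
next
  case (Mu f)
  have eq: "computes (Mu f) xs y \<longleftrightarrow>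
      computes f (y # xs) 0 \<and> (\<forall>m<y. \<exists>v. computes f (m # xs) (Suc v))" for xs y
    by (blast intro: computes.Mu elim: computes_MuE)
  \<comment> \<open>\<open>k\<close> is the number of quantifiers above the occurrence: 0 for the
    value at the result, 2 below the bounded and the existential quantifier.\<close>
  have f: "semidecidable (\<lambda>e. computes f (Z e # map (\<lambda>i. X i (\<lambda>i. e (i + k))) [0..<n]) (V e))"
    if "recursive Z" "recursive V" for Z V k
    unfolding env_Cons
  proof (rule Mu.IH)
    show "recursive (\<lambda>e. case i of 0 \<Rightarrow> Z e | Suc j \<Rightarrow> X j (\<lambda>i. e (i + k)))" for i
      using that by (intro recursive_case_nat recursive_var recursive_subst[OF Mu.prems(1)])
  qed (rule that)
  show ?case unfolding eq
  proof (intro semidecidable_ex semidecidable_conj semidecidable_ball)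
    show "semidecidable (\<lambda>e. computes f (Y e # map (\<lambda>i. X i e) [0..<n]) 0)"
      using f[OF Mu.prems(2) recursive_const, of 0] by simp
    show "semidecidable (\<lambda>e. computes f (e (Suc 0) # map (\<lambda>i. X i (\<lambda>i. e (Suc (Suc i)))) [0..<n]) (Suc (e 0)))"
      using f[OF recursive_var recursive_Suc[OF recursive_var], of 1 2] by simp
  qed (rule Mu.prems(2))
qed

text \<open>A term witnessing \<open>recursive\<close> is only known to work on long lists, while
  the notions of the theorem feed it lists of a fixed length. Padding with zeros closes the
  gap.\<close>

lemma recursive_fixed_arity:
  assumes "recursive F"
  shows "\<exists>f. \<forall>xs. length xs = k \<longrightarrow> computes f xs (F (\<lambda>i. if i < k then xs ! i else 0))"
proof -
  obtain f N where f: "\<And>m e. N \<le> m \<Longrightarrow> computes f (map e [0..<m]) (F e)"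
    using assms unfolding recursive_def by blast
  let ?gs = "map Proj [0..<k] @ replicate N Zero"
  have "computes (Comp f ?gs) xs (F (\<lambda>i. if i < k then xs ! i else 0))" if xs: "length xs = k" for xs
  proof (rule computes.Comp)
    let ?ys = "map (\<lambda>i. if i < k then xs ! i else 0) [0..<k + N]"
    show "computes f ?ys (F (\<lambda>i. if i < k then xs ! i else 0))" by (rule f) simp
    show "\<forall>i<length ?gs. computes (?gs ! i) xs (?ys ! i)"
      using xs by (auto simp: nth_append simp del: upt_Suc intro: computes.intros)
  qed simp
  then show ?thesis by blast
qed

text \<open>The enumerating term searches for a witness by \<open>Mu\<close>. The truth value is
  negated because \<open>Mu\<close> stops at the value 0.\<close>

lemma semidecidable_domain:
  assumes "semidecidable P"
  shows "\<exists>f. \<forall>a b. P (\<lambda>i. if i = 0 then a else if i = 1 then b else 0) \<longleftrightarrow> (\<exists>y. computes f [a, b] y)"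
proof -
  obtain Q where Q: "decidable (\<lambda>e. Q (e 0) (\<lambda>i. e (Suc i)))" "\<And>e. P e \<longleftrightarrow> (\<exists>s. Q s e)"
    using assms(1) unfolding semidecidable_def by blast
  let ?e = "\<lambda>a b i. if i = 0 then a else if i = 1 then b else (0 :: nat)"
  obtain f where f: "\<And>xs. length xs = 3 \<Longrightarrow> computes f xs
      (of_bool (\<not> Q (if (0 :: nat) < 3 then xs ! 0 else 0) (\<lambda>i. if Suc i < 3 then xs ! Suc i else 0)))"
    using recursive_fixed_arity[OF decidable_not[OF Q(1), unfolded decidable_def], of 3] by blast
  have f': "computes f [s, a, b] (of_bool (\<not> Q s (?e a b)))" for s a b
  proof -
    have "(\<lambda>i. if Suc i < 3 then [s, a, b] ! Suc i else 0) = ?e a b"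
      by (auto simp: fun_eq_iff less_Suc_eq numeral_3_eq_3)
    then show ?thesis using f[of "[s, a, b]"] by simp
  qed
  have "P (?e a b) \<longleftrightarrow> (\<exists>y. computes (Mu f) [a, b] y)" for a b
  proof
    assume "P (?e a b)"
    then have ex: "\<exists>s. Q s (?e a b)" using Q(2) by blast
    let ?s = "LEAST s. Q s (?e a b)"
    have "Q ?s (?e a b)" using ex by (rule LeastI_ex)
    then have "computes f [?s, a, b] 0" using f'[of ?s a b] by simp
    moreover have "\<exists>y. computes f [s, a, b] (Suc y)" if "s < ?s" for s
      using f'[of s a b] not_less_Least[OF that] by auto
    ultimately show "\<exists>y. computes (Mu f) [a, b] y" by (blast intro: computes.Mu)
  next
    assume "\<exists>y. computes (Mu f) [a, b] y"
    then obtain y where "computes f [y, a, b] 0" by (blast elim: computes_MuE)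
    then have "of_bool (\<not> Q y (?e a b)) = (0 :: nat)" using f' computes_deterministic by blast
    then show "P (?e a b)" using Q(2) by (auto split: if_splits)
  qed
  then show ?thesis by blast
qed

section \<open>Small values of Brownian motion on an interval\<close>

lemma (in prob_space) prob_normal_ge:
  assumes X: "distributed M lborel X (normal_density 0 \<sigma>)" and "0 < \<sigma>" "\<sigma> \<le> \<epsilon>"
  shows "prob {\<omega> \<in> space M. \<bar>X \<omega>\<bar> < 2 * \<epsilon>} \<ge> 1 / 2"
proof -
  have X_meas [measurable]: "X \<in> borel_measurable M"
    using distributed_measurable[OF X] by simp
  have "integrable M (\<lambda>\<omega>. X \<omega> ^ 2)"
    using distributed_integrable[OF X, of "\<lambda>x. x ^ 2"] integrable_normal_moment[OF assms(2), of 0 2]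
    by simp
  from Chebyshev_inequality[OF X_meas this, of "2 * \<epsilon>"]
  have "prob {\<omega> \<in> space M. 2 * \<epsilon> \<le> \<bar>X \<omega>\<bar>} \<le> \<sigma>\<^sup>2 / (2 * \<epsilon>)\<^sup>2"
    using assms normal_distributed_expectation[OF _ X] normal_distributed_variance[OF _ X] by simp
  also have "\<dots> \<le> 1 / 2"
  proof -
    have "\<sigma>\<^sup>2 \<le> \<epsilon>\<^sup>2" using assms by (intro power_mono) auto
    then have "\<sigma>\<^sup>2 * 2 \<le> 4 * \<epsilon>\<^sup>2" using zero_le_power2[of \<epsilon>] by linarith
    then show ?thesis using assms by (simp add: power_mult_distrib divide_simps)
  qed
  finally have "prob {\<omega> \<in> space M. 2 * \<epsilon> \<le> \<bar>X \<omega>\<bar>} \<le> 1 / 2" .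
  moreover have "{\<omega> \<in> space M. \<bar>X \<omega>\<bar> < 2 * \<epsilon>} = space M - {\<omega> \<in> space M. 2 * \<epsilon> \<le> \<bar>X \<omega>\<bar>}" by auto
  moreover have "{\<omega> \<in> space M. 2 * \<epsilon> \<le> \<bar>X \<omega>\<bar>} \<in> events" by measurable
  ultimately show ?thesis by (simp add: prob_compl)
qed

text \<open>The density is at most 1 / (\<sigma> * sqrt (2 * pi)), here rounded up to 1 / \<sigma>,
  and the interval has length 2 * \<epsilon>.\<close>

lemma (in prob_space) prob_normal_le:
  assumes X: "distributed M lborel X (normal_density 0 \<sigma>)" and "0 < \<sigma>" "0 \<le> \<epsilon>"
  shows "prob {\<omega> \<in> space M. \<bar>X \<omega>\<bar> < \<epsilon>} \<le> 2 * \<epsilon> / \<sigma>"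
proof -
  have dens: "normal_density 0 \<sigma> x \<le> 1 / \<sigma>" for x
  proof -
    have "normal_density 0 \<sigma> x \<le> 1 / sqrt (2 * pi * \<sigma>\<^sup>2) * 1"
      unfolding normal_density_def by (intro mult_left_mono) auto
    also have "\<dots> \<le> 1 / \<sigma>"
    proof -
      have "\<sigma>\<^sup>2 \<le> 2 * pi * \<sigma>\<^sup>2" using pi_ge_two by (simp add: mult_le_cancel_right1)
      then have "\<sigma> \<le> sqrt (2 * pi * \<sigma>\<^sup>2)" using assms by (simp add: real_le_rsqrt)
      then show ?thesis using assms by (simp add: frac_le)
    qed
    finally show ?thesis .
  qed
  have "emeasure M (X -` {-\<epsilon><..<\<epsilon>} \<inter> space M) =
      (\<integral>\<^sup>+x. ennreal (normal_density 0 \<sigma> x) * indicator {-\<epsilon><..<\<epsilon>} x \<partial>lborel)"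
    by (rule distributed_emeasure[OF X]) simp
  also have "\<dots> \<le> (\<integral>\<^sup>+x. ennreal (1 / \<sigma>) * indicator {-\<epsilon><..<\<epsilon>} x \<partial>lborel)"
    by (intro nn_integral_mono mult_right_mono ennreal_leI dens) simp
  also have "\<dots> = ennreal (1 / \<sigma>) * ennreal (2 * \<epsilon>)"
    using assms by (subst nn_integral_cmult_indicator) auto
  also have "\<dots> = ennreal (2 * \<epsilon> / \<sigma>)" using assms by (simp flip: ennreal_mult)
  finally have "emeasure M (X -` {-\<epsilon><..<\<epsilon>} \<inter> space M) \<le> ennreal (2 * \<epsilon> / \<sigma>)" .
  moreover have "X -` {-\<epsilon><..<\<epsilon>} \<inter> space M = {\<omega> \<in> space M. \<bar>X \<omega>\<bar> < \<epsilon>}" by auto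
  ultimately show ?thesis using assms by (simp add: emeasure_eq_measure)
qed

section \<open>Hitting probabilities under Wiener measure\<close>

locale wiener =
  fixes W :: "(real \<Rightarrow> real) measure"
  assumes wiener: "wiener_measure W"
begin

sublocale prob_space W using wiener by (simp add: wiener_measure_def)

lemma increment_distributed:
  "0 \<le> s \<Longrightarrow> s < t \<Longrightarrow> t \<le> 1 \<Longrightarrow>
    distributed W lborel (\<lambda>B. B t - B s) (normal_density 0 (sqrt (t - s)))"
  using wiener by (simp add: wiener_measure_def)

text \<open>Measurability is read off from \<open>distributed\<close>, hence obtained for
  increments. This is why the events below compare \<open>B t\<close> with \<open>B 0\<close>
  instead of 0.\<close>

lemma increment_measurable [measurable (raw)]:
  assumes "t \<in> {0..1}" and "s \<in> {0..1}"
  shows "(\<lambda>B. B t - B s) \<in> borel_measurable W"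
proof (cases s t rule: linorder_cases)
  case less
  then show ?thesis using distributed_measurable[OF increment_distributed[of s t]] assms by simp
next
  case greater
  then have "(\<lambda>B. B s - B t) \<in> borel_measurable W"
    using distributed_measurable[OF increment_distributed[of t s]] assms by simp
  then have "(\<lambda>B. - (B s - B t)) \<in> borel_measurable W" by (rule borel_measurable_uminus)
  then show ?thesis by simp
qed simp

lemma AE_start: "AE B in W. B 0 = 0"
  using wiener by (simp add: wiener_measure_def)

definition first_hit :: "real set \<Rightarrow> real \<Rightarrow> real \<Rightarrow> (real \<Rightarrow> real) set" where
  "first_hit T \<epsilon> s =
     {B \<in> space W. \<bar>B s - B 0\<bar> < \<epsilon> \<and> (\<forall>u\<in>T. u < s \<longrightarrow> \<epsilon> \<le> \<bar>B u - B 0\<bar>)}"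

lemma first_hit_measurable:
  assumes "finite T" "T \<subseteq> {0..1}" "s \<in> {0..1}"
  shows "first_hit T \<epsilon> s \<in> sets W"
proof -
  have T: "finite {u \<in> T. u < s}" using assms(1) by simp
  have "first_hit T \<epsilon> s = {B \<in> space W. \<bar>B s - B 0\<bar> < \<epsilon>} \<inter>
      {B \<in> space W. \<forall>u\<in>{u \<in> T. u < s}. \<epsilon> \<le> \<bar>B u - B 0\<bar>}"
    by (auto simp: first_hit_def)
  moreover have "{B \<in> space W. \<bar>B s - B 0\<bar> < \<epsilon>} \<in> sets W"
    using increment_measurable[of s 0] assms(3) by measurable
  moreover have "{B \<in> space W. \<epsilon> \<le> \<bar>B u - B 0\<bar>} \<in> sets W" if "u \<in> T" for u
  proof -
    have [measurable]: "(\<lambda>B. B u - B 0) \<in> borel_measurable W"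
      using assms(2) that by (intro increment_measurable) auto
    show ?thesis by measurable
  qed
  ultimately show ?thesis using T
    by (simp only:) (intro sets.Int sets.sets_Collect_finite_All; simp)
qed

text \<open>The first event is a condition on the increments between 0, the times of
  \<open>T\<close> before \<open>s\<close>, and \<open>s\<close> itself; \<open>B e - B s\<close> is
  the next increment and independent of these.\<close>

lemma first_hit_indep:
  assumes T: "finite T" "T \<subseteq> {0<..}" and s: "0 < s" "s < e" "e \<le> 1"
  shows "prob (first_hit T \<epsilon> s \<inter> {B \<in> space W. \<bar>B e - B s\<bar> < \<delta>}) =
    prob (first_hit T \<epsilon> s) * prob {B \<in> space W. \<bar>B e - B s\<bar> < \<delta>}"
proof -
  define l where "l = sorted_list_of_set {u \<in> T. u < s}"
  define n where "n = Suc (length l)"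
  \<comment> \<open>The sorted partition 0, the times of \<open>T\<close> below \<open>s\<close>,
    \<open>s\<close>, \<open>e\<close>, so that \<open>t n = s\<close> and
    \<open>t (Suc n) = e\<close>.\<close>
  define t where "t i = (0 # l @ [s, e]) ! i" for i
  define X where "X i B = B (t (Suc i)) - B (t i)" for i and B :: "real \<Rightarrow> real"
  have l: "set l = {u \<in> T. u < s}" "sorted_wrt (<) l"
    unfolding l_def using T by auto
  have "sorted_wrt (<) (0 # l @ [s, e])"
    using l T s by (auto simp: sorted_wrt_append)
  then have less: "t i < t j" if "i < j" "j < n + 2" for i j
    unfolding t_def using that by (intro sorted_wrt_nth_less[where P = "(<)"]) (auto simp: n_def)
  have t0: "t 0 = 0" and tn: "t n = s" and tSn: "t (Suc n) = e"
    by (auto simp: t_def n_def nth_append)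
  have t_range: "t i \<in> {0..1}" if "i \<le> Suc n" for i
  proof -
    have "0 \<le> t i" using less[of 0 i] t0 that by (cases "i = 0") auto
    moreover have "t i \<le> e" using less[of i "Suc n"] tSn that by (cases "i = Suc n") auto
    ultimately show ?thesis using s by simp
  qed
  have past: "{u \<in> T. u < s} = t ` {1..<n}"
  proof -
    have "set l = (\<lambda>i. l ! i) ` {..<length l}" by (auto simp: set_conv_nth)
    also have "\<dots> = (\<lambda>i. t (Suc i)) ` {..<length l}"
      by (intro image_cong) (auto simp: t_def nth_append)
    also have "\<dots> = t ` Suc ` {..<length l}" by (simp only: image_image)
    also have "Suc ` {..<length l} = {1..<n}"
      by (auto simp: n_def image_iff Suc_le_eq gr0_conv_Suc)
    finally show ?thesis using l by simp
  qed
  have indep: "indep_vars (\<lambda>_. borel) X {..<Suc n}"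
    using wiener t_range less unfolding wiener_measure_def X_def by auto
  have tele: "(\<Sum>i<j. X i B) = B (t j) - B 0" for j B
    using sum_lessThan_telescope[of "\<lambda>i. B (t i)" j] by (simp add: X_def t0)
  let ?P = "PiM {..<n} (\<lambda>_. borel :: real measure)"
  \<comment> \<open>The first-hit event in the space of increment vectors: the partial sums recover
    the values \<open>B (t j) - B 0\<close>.\<close>
  define S where "S = {f \<in> space ?P. \<bar>\<Sum>i<n. f i\<bar> < \<epsilon> \<and> (\<forall>j\<in>{1..<n}. \<epsilon> \<le> \<bar>\<Sum>i<j. f i\<bar>)}"
  have sum_meas: "(\<lambda>f. \<Sum>i<j. f i) \<in> borel_measurable ?P" if "j \<le> n" for j
    using that by (intro borel_measurable_sum measurable_component_singleton) auto
  have "S = {f \<in> space ?P. \<bar>\<Sum>i<n. f i\<bar> < \<epsilon>} \<inter>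
      {f \<in> space ?P. \<forall>j\<in>{1..<n}. \<epsilon> \<le> \<bar>\<Sum>i<j. f i\<bar>}"
    by (auto simp: S_def)
  moreover have "{f \<in> space ?P. \<bar>\<Sum>i<n. f i\<bar> < \<epsilon>} \<in> sets ?P"
    using sum_meas[of n] by measurable
  moreover have "{f \<in> space ?P. \<epsilon> \<le> \<bar>\<Sum>i<j. f i\<bar>} \<in> sets ?P" if "j \<in> {1..<n}" for j
  proof -
    have [measurable]: "(\<lambda>f. \<Sum>i<j. f i) \<in> borel_measurable ?P"
      using that by (intro sum_meas) auto
    show ?thesis by measurable
  qed
  ultimately have S_sets: "S \<in> sets ?P"
    by (simp only:) (intro sets.Int sets.sets_Collect_finite_All; simp)
  have "indep_var ?P (\<lambda>B. restrict (\<lambda>i. X i B) {..<n}) (PiM {n} (\<lambda>_. borel)) (\<lambda>B. restrict (\<lambda>i. X i B) {n})"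
    by (rule indep_var_restrict[OF indep]) auto
  \<comment> \<open>The indicator makes a real random variable of the event; the event is its
    preimage of 1.\<close>
  then have "indep_var borel ((indicator S :: _ \<Rightarrow> real) \<circ> (\<lambda>B. restrict (\<lambda>i. X i B) {..<n}))
      borel ((\<lambda>f. f n) \<circ> (\<lambda>B. restrict (\<lambda>i. X i B) {n}))"
    by (rule indep_var_compose) (use S_sets in auto)
  then have "indep_var borel (\<lambda>B. indicator S (restrict (\<lambda>i. X i B) {..<n}) :: real) borel (X n)"
    by (simp add: comp_def)
  from indep_varD[OF this, of "{1}" "{-\<delta><..<\<delta>}"]
  have "prob {B \<in> space W. restrict (\<lambda>i. X i B) {..<n} \<in> S \<and> X n B \<in> {-\<delta><..<\<delta>}} =
      prob {B \<in> space W. restrict (\<lambda>i. X i B) {..<n} \<in> S} * prob {B \<in> space W. X n B \<in> {-\<delta><..<\<delta>}}"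
    by (simp add: vimage_def Int_def indicator_eq_1_iff conj_ac)
  moreover have "restrict (\<lambda>i. X i B) {..<n} \<in> S \<longleftrightarrow>
      \<bar>B s - B 0\<bar> < \<epsilon> \<and> (\<forall>u\<in>T. u < s \<longrightarrow> \<epsilon> \<le> \<bar>B u - B 0\<bar>)" for B
  proof -
    have "(\<Sum>i<j. restrict (\<lambda>i. X i B) {..<n} i) = B (t j) - B 0" if "j \<le> n" for j
      using that unfolding tele[symmetric] by (intro sum.cong) auto
    then have "restrict (\<lambda>i. X i B) {..<n} \<in> S \<longleftrightarrow>
        \<bar>B s - B 0\<bar> < \<epsilon> \<and> (\<forall>j\<in>{1..<n}. \<epsilon> \<le> \<bar>B (t j) - B 0\<bar>)"
      by (auto simp: S_def space_PiM tn)
    also have "(\<forall>j\<in>{1..<n}. \<epsilon> \<le> \<bar>B (t j) - B 0\<bar>) \<longleftrightarrow> (\<forall>u\<in>{u \<in> T. u < s}. \<epsilon> \<le> \<bar>B u - B 0\<bar>)"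
      unfolding past by simp
    finally show ?thesis by blast
  qed
  moreover have "X n B \<in> {-\<delta><..<\<delta>} \<longleftrightarrow> \<bar>B e - B s\<bar> < \<delta>" for B
    by (auto simp: X_def tn tSn)
  moreover have "first_hit T \<epsilon> s \<inter> {B \<in> space W. \<bar>B e - B s\<bar> < \<delta>} =
      {B \<in> space W. (\<bar>B s - B 0\<bar> < \<epsilon> \<and> (\<forall>u\<in>T. u < s \<longrightarrow> \<epsilon> \<le> \<bar>B u - B 0\<bar>)) \<and> \<bar>B e - B s\<bar> < \<delta>}"
    by (auto simp: first_hit_def)
  ultimately show ?thesis by (simp only: first_hit_def[symmetric])
qed

text \<open>Finiteness of \<open>T\<close> guarantees a first small value, and
  \<open>e - a \<le> \<epsilon>\<^sup>2\<close> bounds the standard deviation of the remaining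
  increment by \<epsilon>. In the constant 12, a factor 2 pays for the conditional probability one
  half, and 2 * 3 is the density bound at 3 * \<epsilon>.\<close>

lemma finite_hit_prob:
  assumes T: "finite T" "T \<subseteq> {a..e}" "T \<subseteq> {0<..}" and e: "0 < e" "e \<le> 1"
    and \<epsilon>: "0 < \<epsilon>" "e - a \<le> \<epsilon>\<^sup>2"
  shows "prob {B \<in> space W. \<exists>t\<in>T. \<bar>B t - B 0\<bar> < \<epsilon>} \<le> 12 * \<epsilon> / sqrt e"
proof -
  let ?F = "\<lambda>s. {B \<in> space W. \<bar>B e - B s\<bar> < 2 * \<epsilon>}"
  have T01: "T \<subseteq> {0..1}" using T e by force
  have H: "first_hit T \<epsilon> s \<in> sets W" if "s \<in> T" for s
    using first_hit_measurable[OF T(1) T01] T01 that by blast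
  have F: "?F s \<in> sets W" if "s \<in> T" for s
  proof -
    have [measurable]: "(\<lambda>B. B e - B s) \<in> borel_measurable W"
      using T01 e that by (intro increment_measurable) auto
    show ?thesis by measurable
  qed
  have disj: "disjoint_family_on (first_hit T \<epsilon>) T"
    unfolding disjoint_family_on_def first_hit_def by (auto simp: disjoint_iff) (metis linorder_neqE not_less)
  have half: "prob (first_hit T \<epsilon> s) / 2 \<le> prob (first_hit T \<epsilon> s \<inter> ?F s)" if s: "s \<in> T" for s
  proof (cases "s = e")
    case True
    \<comment> \<open>The remaining increment is 0 here and has no normal density.\<close>
    then have "?F s = space W" using \<epsilon> by auto
    then show ?thesis using H[OF s] by (simp add: measure_nonneg)
  next
    case False
    then have se: "0 < s" "s < e" using T s by force+
    have "e - s \<le> \<epsilon>\<^sup>2" using T(2) s \<epsilon>(2) by force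
    then have "1 / 2 \<le> prob (?F s)"
      using se e \<epsilon> by (intro prob_normal_ge[OF increment_distributed]) (auto simp: real_sqrt_le_iff real_le_lsqrt)
    then show ?thesis
      using first_hit_indep[OF T(1,3) se e(2)] mult_left_mono[of "1/2" "prob (?F s)" "prob (first_hit T \<epsilon> s)"]
      by simp
  qed
  have cover: "{B \<in> space W. \<exists>t\<in>T. \<bar>B t - B 0\<bar> < \<epsilon>} \<subseteq> (\<Union>s\<in>T. first_hit T \<epsilon> s)"
  proof
    fix B assume B: "B \<in> {B \<in> space W. \<exists>t\<in>T. \<bar>B t - B 0\<bar> < \<epsilon>}"
    let ?S = "{t \<in> T. \<bar>B t - B 0\<bar> < \<epsilon>}"
    have "finite ?S" "?S \<noteq> {}" using B T by auto
    then have "Min ?S \<in> ?S" by (rule Min_in)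
    moreover have "\<And>u. u \<in> ?S \<Longrightarrow> Min ?S \<le> u" using \<open>finite ?S\<close> by (rule Min_le)
    ultimately show "B \<in> (\<Union>s\<in>T. first_hit T \<epsilon> s)"
      using B by (intro UN_I[of "Min ?S"]) (force simp: first_hit_def not_less[symmetric])+
  qed
  have "prob {B \<in> space W. \<exists>t\<in>T. \<bar>B t - B 0\<bar> < \<epsilon>} \<le> prob (\<Union>s\<in>T. first_hit T \<epsilon> s)"
    using H T by (intro finite_measure_mono cover sets.finite_UN) auto
  also have "\<dots> = (\<Sum>s\<in>T. prob (first_hit T \<epsilon> s))"
    using H T disj by (intro finite_measure_finite_Union) auto
  also have "\<dots> \<le> (\<Sum>s\<in>T. 2 * prob (first_hit T \<epsilon> s \<inter> ?F s))"
    using half by (intro sum_mono) force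
  also have "\<dots> = 2 * (\<Sum>s\<in>T. prob (first_hit T \<epsilon> s \<inter> ?F s))"
    by (rule sum_distrib_left[symmetric])
  also have "(\<Sum>s\<in>T. prob (first_hit T \<epsilon> s \<inter> ?F s)) = prob (\<Union>s\<in>T. first_hit T \<epsilon> s \<inter> ?F s)"
  proof (rule finite_measure_finite_Union[symmetric])
    show "disjoint_family_on (\<lambda>s. first_hit T \<epsilon> s \<inter> ?F s) T"
      using disj unfolding disjoint_family_on_def by blast
  qed (use H F T in auto)
  also have "\<dots> \<le> prob {B \<in> space W. \<bar>B e - B 0\<bar> < 3 * \<epsilon>}"
  proof (rule finite_measure_mono)
    show "{B \<in> space W. \<bar>B e - B 0\<bar> < 3 * \<epsilon>} \<in> sets W"
    proof -
      have [measurable]: "(\<lambda>B. B e - B 0) \<in> borel_measurable W"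
        using e by (intro increment_measurable) auto
      show ?thesis by measurable
    qed
  qed (auto simp: first_hit_def)
  also have "\<dots> \<le> 2 * (3 * \<epsilon>) / sqrt (e - 0)"
    using e \<epsilon> by (intro prob_normal_le increment_distributed) auto
  finally show ?thesis by simp
qed

text \<open>Rational times make this a countable union, and they include the nodes i / n with 0 < i
  that the test inspects. Time 0 is left out, as the increment vanishes there.\<close>

definition hit :: "real \<Rightarrow> real \<Rightarrow> real \<Rightarrow> (real \<Rightarrow> real) set" where
  "hit a e \<epsilon> = {B \<in> space W. \<exists>t\<in>\<rat> \<inter> {a..e} \<inter> {0<..}. \<bar>B t - B 0\<bar> < \<epsilon>}"

lemma hit_measurable: "e \<le> 1 \<Longrightarrow> hit a e \<epsilon> \<in> sets W"
proof -
  assume e: "e \<le> 1"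
  have "hit a e \<epsilon> = (\<Union>t\<in>\<rat> \<inter> {a..e} \<inter> {0<..}. {B \<in> space W. \<bar>B t - B 0\<bar> < \<epsilon>})"
    by (auto simp: hit_def)
  also have "\<dots> \<in> sets W"
  proof (intro sets.countable_UN'' countable_Int1 countable_rat)
    fix t assume "t \<in> \<rat> \<inter> {a..e} \<inter> {0<..}"
    then have "t \<in> {0..1}" using e by auto
    then show "{B \<in> space W. \<bar>B t - B 0\<bar> < \<epsilon>} \<in> sets W"
      using increment_measurable[of t 0] by measurable
  qed
  finally show ?thesis .
qed

text \<open>The bound for finite sets of times does not depend on the set, so it passes to an
  increasing union of such sets. An enumeration by the naturals exists only if there is a time at
  all.\<close>

lemma hit_prob:
  assumes e: "0 < e" "e \<le> 1" and \<epsilon>: "0 < \<epsilon>" "e - a \<le> \<epsilon>\<^sup>2"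
  shows "prob (hit a e \<epsilon>) \<le> 12 * \<epsilon> / sqrt e"
proof (cases "\<rat> \<inter> {a..e} \<inter> {0<..} = {}")
  case True
  then have "hit a e \<epsilon> = {}" by (auto simp: hit_def)
  then show ?thesis using e \<epsilon> by simp
next
  case False
  moreover have "countable (\<rat> \<inter> {a..e} \<inter> {0<..})" by (intro countable_Int1 countable_rat)
  ultimately obtain f :: "nat \<Rightarrow> real" where f: "\<rat> \<inter> {a..e} \<inter> {0<..} = range f"
    by (metis range_from_nat_into)
  let ?A = "\<lambda>n. {B \<in> space W. \<exists>t\<in>f ` {..<n}. \<bar>B t - B 0\<bar> < \<epsilon>}"
  have range: "f i \<in> {a..e}" "f i \<in> {0<..}" "f i \<in> {0..1}" for i
    using rangeI[of f i] e unfolding f[symmetric] by auto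
  have "?A n \<in> sets W" for n
  proof -
    have "?A n = (\<Union>i<n. {B \<in> space W. \<bar>B (f i) - B 0\<bar> < \<epsilon>})" by auto
    also have "\<dots> \<in> sets W"
    proof (intro sets.finite_UN)
      fix i show "{B \<in> space W. \<bar>B (f i) - B 0\<bar> < \<epsilon>} \<in> sets W"
        using increment_measurable[of "f i" 0] range[of i] by measurable
    qed simp
    finally show ?thesis .
  qed
  moreover have "incseq ?A" by (force simp: incseq_def)
  ultimately have "(\<lambda>n. prob (?A n)) \<longlonglongrightarrow> prob (\<Union>n. ?A n)"
    by (intro finite_Lim_measure_incseq) auto
  moreover have "prob (?A n) \<le> 12 * \<epsilon> / sqrt e" for n
    using range e \<epsilon> by (intro finite_hit_prob[of _ a]) auto
  moreover have "(\<Union>n. ?A n) = hit a e \<epsilon>" unfolding hit_def f by auto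
  ultimately show ?thesis by (auto intro: LIMSEQ_le_const2)
qed

end

section \<open>Strings, prefix-free machines and dyadic intervals\<close>

lemma str_code_Nil [simp]: "str_code [] = 1"
  by (simp add: str_code_def)

lemma str_code_snoc [simp]: "str_code (\<sigma> @ [b]) = 2 * str_code \<sigma> + of_bool b"
  by (simp add: str_code_def)

lemma str_code_bounds: "2 ^ length \<sigma> \<le> str_code \<sigma>" "str_code \<sigma> < 2 ^ Suc (length \<sigma>)"
  by (induction \<sigma> rule: rev_induct) auto

lemma str_code_pos: "0 < str_code \<sigma>"
  using str_code_bounds(1)[of \<sigma>] by (meson less_le_trans zero_less_numeral zero_less_power)

lemma str_code_inject: "str_code \<sigma> = str_code \<tau> \<longleftrightarrow> \<sigma> = \<tau>"
proof (induction \<sigma> arbitrary: \<tau> rule: rev_induct)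
  case Nil
  show ?case
  proof (cases \<tau> rule: rev_cases)
    case (snoc \<tau>' c)
    have "1 < str_code \<tau>" using str_code_pos[of \<tau>'] unfolding snoc str_code_snoc by linarith
    then show ?thesis using snoc by auto
  qed simp
next
  case (snoc b \<sigma>)
  show ?case
  proof (cases \<tau> rule: rev_cases)
    case Nil
    have "1 < str_code (\<sigma> @ [b])" using str_code_pos[of \<sigma>] unfolding str_code_snoc by linarith
    then show ?thesis using Nil by auto
  next
    case (snoc \<tau>' c)
    have "2 * str_code \<sigma> + of_bool b = 2 * str_code \<tau>' + of_bool c \<longleftrightarrow>
        str_code \<sigma> = str_code \<tau>' \<and> b = c" by (cases b; cases c) (auto, presburger+)
    then show ?thesis using snoc.IH snoc by auto
  qed
qed

lemma str_code_surj: "0 < r \<Longrightarrow> \<exists>\<rho>. r = str_code \<rho>"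
proof (induction r rule: less_induct)
  case (less r)
  show ?case
  proof (cases "r = 1")
    case True
    then show ?thesis by (intro exI[of _ "[]"]) simp
  next
    case False
    then have "r div 2 < r" "0 < r div 2" using less.prems by (auto simp: div_greater_zero_iff)
    then obtain \<rho> where \<rho>: "r div 2 = str_code \<rho>" using less.IH by blast
    have "r = 2 * (r div 2) + of_bool (odd r)" by (cases "even r") (auto elim: evenE oddE)
    then have "r = str_code (\<rho> @ [odd r])" unfolding \<rho> by simp
    then show ?thesis ..
  qed
qed

definition code_length :: "nat \<Rightarrow> nat" where
  "code_length y = (LEAST n. y < 2 ^ Suc n)"

lemma code_length_str_code [simp]: "code_length (str_code \<sigma>) = length \<sigma>"
  unfolding code_length_def
proof (rule Least_equality)
  fix n assume "str_code \<sigma> < 2 ^ Suc n"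
  then have "2 ^ length \<sigma> < (2 :: nat) ^ Suc n" using str_code_bounds(1)[of \<sigma>] by linarith
  then have "length \<sigma> < Suc n" by (rule power_less_imp_less_exp[rotated]) simp
  then show "length \<sigma> \<le> n" by simp
qed (rule str_code_bounds)

lemma recursive_code_length: "recursive F \<Longrightarrow> recursive (\<lambda>e. code_length (F e))"
proof (rule recursive_fun1[of code_length])
  have "decidable (\<lambda>e. \<not> e 1 < 2 ^ Suc (e 0))"
    by (intro recursive_intros)
  then have "recursive (\<lambda>e. LEAST n. of_bool (\<not> e 0 < 2 ^ Suc n) = (0 :: nat))"
    unfolding decidable_def
  proof (intro recursive_least)
    fix e :: "nat \<Rightarrow> nat"
    have "e 0 < 2 ^ Suc (e 0)" by (metis less_exp less_trans lessI)
    then show "\<exists>y. of_bool (\<not> e 0 < 2 ^ Suc y) = (0 :: nat)" by auto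
  qed simp
  then show "recursive (\<lambda>e. code_length (e 0))" by (simp add: code_length_def)
qed

text \<open>Extend each string in all ways to the maximal length N. By prefix-freeness the sets of
  extensions are disjoint, and together they contain at most 2 ^ N strings.\<close>

lemma kraft_inequality:
  fixes F :: "bool list set"
  assumes "finite F" and prefix_free: "\<forall>\<sigma>\<in>F. \<forall>\<rho>. \<rho> \<noteq> [] \<longrightarrow> \<sigma> @ \<rho> \<notin> F"
  shows "(\<Sum>\<rho>\<in>F. (1 / 2) ^ length \<rho>) \<le> (1 :: real)"
proof -
  define N where "N = Max (length ` F)"
  have N: "length \<rho> \<le> N" if "\<rho> \<in> F" for \<rho> using that assms(1) by (simp add: N_def)
  define E where "E \<rho> = (@) \<rho> ` {\<tau> :: bool list. length \<tau> = N - length \<rho>}" for \<rho>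
  have lists: "finite {\<tau> :: bool list. length \<tau> = n}" "card {\<tau> :: bool list. length \<tau> = n} = 2 ^ n" for n
    using finite_lists_length_eq[of "UNIV :: bool set" n] card_lists_length_eq[of "UNIV :: bool set" n]
    by (simp_all add: card_UNIV_bool)
  have card_E: "card (E \<rho>) = 2 ^ (N - length \<rho>)" for \<rho>
    unfolding E_def by (subst card_image) (auto simp: inj_on_def lists)
  have "E \<rho> \<inter> E \<rho>' = {}" if "\<rho> \<in> F" "\<rho>' \<in> F" "\<rho> \<noteq> \<rho>'" for \<rho> \<rho>'
  proof (rule ccontr)
    assume "E \<rho> \<inter> E \<rho>' \<noteq> {}"
    then obtain \<tau> \<tau>' where "\<rho> @ \<tau> = \<rho>' @ \<tau>'" by (auto simp: E_def)
    then show False using that prefix_free by (auto simp: append_eq_append_conv2)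
  qed
  then have "card (\<Union>\<rho>\<in>F. E \<rho>) = (\<Sum>\<rho>\<in>F. card (E \<rho>))"
    using assms(1) by (intro card_UN_disjoint) (auto simp: E_def lists)
  moreover have "card (\<Union>\<rho>\<in>F. E \<rho>) \<le> card {\<tau> :: bool list. length \<tau> = N}"
    by (rule card_mono[OF lists(1)]) (auto simp: E_def dest: N)
  ultimately have "(\<Sum>\<rho>\<in>F. 2 ^ (N - length \<rho>)) \<le> (2 :: nat) ^ N" by (simp add: card_E lists)
  then have "real (\<Sum>\<rho>\<in>F. 2 ^ (N - length \<rho>)) \<le> real (2 ^ N)" by (rule of_nat_mono)
  moreover have "real (\<Sum>\<rho>\<in>F. 2 ^ (N - length \<rho>)) = 2 ^ N * (\<Sum>\<rho>\<in>F. (1 / 2) ^ length \<rho>)"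
    unfolding of_nat_sum sum_distrib_left
  proof (intro sum.cong refl)
    fix \<rho> assume "\<rho> \<in> F"
    then have "(2 :: real) ^ N = 2 ^ (N - length \<rho>) * 2 ^ length \<rho>"
      using N by (simp flip: power_add)
    then show "real (2 ^ (N - length \<rho>)) = 2 ^ N * (1 / 2) ^ length \<rho>"
      by (simp add: power_divide)
  qed
  ultimately show ?thesis by simp
qed

text \<open>The machine that halts on the empty program alone, with output \<tau>, is prefix-free,
  so \<open>U\<close> simulates it. Without this, the \<open>LEAST\<close> in
  \<open>prefix_complexity\<close> could range over an empty set.\<close>

lemma optimal_machine_onto:
  assumes "optimal_prefix_free_machine U"
  shows "\<exists>\<rho>. U \<rho> = Some \<tau>"
proof -
  define M where "M = [([] :: bool list) \<mapsto> \<tau>]"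
  have "decidable (\<lambda>e. \<not> e 1 = 1)" by (intro recursive_intros)
  then obtain h where "\<And>xs. length xs = 2 \<Longrightarrow> computes h xs (of_bool (\<not> (if (1 :: nat) < 2 then xs ! 1 else 0) = 1))"
    using recursive_fixed_arity[of _ 2] unfolding decidable_def by blast
  from this[of "[_, _]"] have h: "computes h [n, r] (of_bool (r \<noteq> 1))" for n r by simp
  obtain c where "\<And>xs. length xs = 1 \<Longrightarrow> computes c xs (str_code \<tau>)"
    using recursive_fixed_arity[OF recursive_const, of 1 "str_code \<tau>"] by blast
  from this[of "[_]"] have c: "computes c [n] (str_code \<tau>)" for n by simp
  \<comment> \<open>\<open>Mu h\<close> diverges unless the input is 1, the code of the empty
    string; \<open>c\<close> is a constant.\<close>
  let ?f = "Comp c [Mu h]"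
  have f: "computes ?f [r] y \<longleftrightarrow> r = 1 \<and> y = str_code \<tau>" for r y
  proof
    assume "computes ?f [r] y"
    then obtain ys where ys: "length ys = 1" "computes (Mu h) [r] (ys ! 0)" "computes c ys y"
      by (auto elim!: computes_CompE)
    have "computes h [ys ! 0, r] 0" using ys(2) by (blast elim: computes_MuE)
    then have "of_bool (r \<noteq> 1) = (0 :: nat)" using h computes_deterministic by blast
    moreover obtain n where "ys = [n]" using ys(1) by (auto simp: length_Suc_conv)
    ultimately show "r = 1 \<and> y = str_code \<tau>"
      using ys(3) c computes_deterministic by (auto split: if_splits)
  next
    assume "r = 1 \<and> y = str_code \<tau>"
    moreover have "computes (Mu h) [1] 0" using h[of 0 1] by (intro computes.Mu) auto
    ultimately show "computes ?f [r] y"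
      using c[of 0] by (intro computes.Comp[where ys = "[0]"]) auto
  qed
  have "computes ?f [str_code \<sigma>] y \<longleftrightarrow> (\<exists>\<tau>'. M \<sigma> = Some \<tau>' \<and> y = str_code \<tau>')" for \<sigma> y
    unfolding f using str_code_inject[of \<sigma> "[]"] by (auto simp: M_def)
  then have "partial_computable_str M" unfolding partial_computable_str_def by blast
  then have "prefix_free_machine M" unfolding prefix_free_machine_def by (auto simp: M_def)
  moreover have "M [] = Some \<tau>" by (simp add: M_def)
  ultimately show ?thesis using assms unfolding optimal_prefix_free_machine_def by blast
qed

lemma prefix_complexity_witness:
  assumes "optimal_prefix_free_machine U"
  shows "\<exists>\<rho>. U \<rho> = Some \<tau> \<and> length \<rho> = prefix_complexity U \<tau>"
proof -
  have "\<exists>n \<sigma>. length \<sigma> = n \<and> U \<sigma> = Some \<tau>" using optimal_machine_onto[OF assms] by blast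
  from LeastI_ex[OF this] show ?thesis unfolding prefix_complexity_def by blast
qed

text \<open>The leading 1 of \<open>str_code \<sigma>\<close> is removed to get the integer with binary representation \<open>\<sigma>\<close>.\<close>

definition cell_left :: "bool list \<Rightarrow> real" where
  "cell_left \<sigma> = real (str_code \<sigma> - 2 ^ length \<sigma>) / 2 ^ length \<sigma>"

definition cell_right :: "bool list \<Rightarrow> real" where
  "cell_right \<sigma> = cell_left \<sigma> + 1 / 2 ^ length \<sigma>"

lemma cell_eq:
  "cell_left \<sigma> = real (str_code \<sigma>) / 2 ^ length \<sigma> - 1"
  "cell_right \<sigma> = (real (str_code \<sigma>) + 1) / 2 ^ length \<sigma> - 1"
  using str_code_bounds(1)[of \<sigma>]
  by (simp_all add: cell_left_def cell_right_def of_nat_diff field_simps)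

lemma cell_bounds: "0 \<le> cell_left \<sigma>" "cell_left \<sigma> < cell_right \<sigma>" "cell_right \<sigma> \<le> 1"
proof -
  have "str_code \<sigma> + 1 \<le> 2 * 2 ^ length \<sigma>" using str_code_bounds(2)[of \<sigma>] by simp
  then have "real (str_code \<sigma> + 1) \<le> real (2 * 2 ^ length \<sigma>)" by (rule of_nat_mono)
  then show "cell_right \<sigma> \<le> 1" by (simp add: cell_eq divide_simps)
qed (simp_all add: cell_left_def cell_right_def)

lemma length_initial_bits [simp]: "length (initial_bits b n) = n"
  by (simp add: initial_bits_def)

text \<open>The rest of the series is at most a geometric series with sum 2 ^ -n. Cells are closed
  since the right end is attained if all later bits are 1, as in the expansion of 1.\<close>

lemma binary_expansion_cell:
  assumes "binary_expansion x b"
  shows "cell_left (initial_bits b n) \<le> x" "x \<le> cell_right (initial_bits b n)"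
proof -
  let ?f = "\<lambda>i. of_bool (b i) / 2 ^ Suc i :: real"
  have sums: "?f sums x" using assms by (simp add: binary_expansion_def)
  have code: "real (str_code (initial_bits b n)) = 2 ^ n * (1 + (\<Sum>i<n. ?f i))"
    by (induction n) (auto simp: initial_bits_def field_simps)
  then have left: "cell_left (initial_bits b n) = (\<Sum>i<n. ?f i)"
    by (simp add: cell_eq)
  then show "cell_left (initial_bits b n) \<le> x"
    using sum_le_suminf[OF sums_summable[OF sums], of "{..<n}"] sums_unique[OF sums] by simp
  have geo: "(\<lambda>i. (1 / 2) ^ Suc n * (1 / 2) ^ i) sums ((1 / 2) ^ Suc n * (1 / (1 - 1 / 2)) :: real)"
    by (intro sums_mult geometric_sums) simp
  have tail: "(\<lambda>i. ?f (i + n)) sums (x - (\<Sum>i<n. ?f i))"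
    using sums by (rule sums_split_initial_segment)
  have le: "?f (i + n) \<le> (1 / 2) ^ Suc n * (1 / 2) ^ i" for i
    by (simp add: power_add power_divide of_bool_def mult_ac)
  have "x - (\<Sum>i<n. ?f i) \<le> (1 / 2) ^ Suc n * (1 / (1 - 1 / 2))"
    by (rule sums_le[OF le tail geo])
  then show "x \<le> cell_right (initial_bits b n)"
    using left by (simp add: cell_right_def power_divide)
qed

section \<open>Polygonal approximation\<close>

lemma mspace_path_space:
  "B \<in> mspace path_space \<longleftrightarrow> B \<in> extensional {0..1} \<and> continuous_on {0..1} B"
proof -
  have "compactin (top_of_set {0..1 :: real}) (topspace (top_of_set {0..1}))"
    by (simp add: compactin_subtopology)
  from compactin_mspace_cfunspace[OF this, of euclidean_metric]
  have "mspace path_space = {B. B \<in> extensional {0..1} \<and> continuous_on {0..1} B}"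
    by (simp add: path_space_def del: mspace_cfunspace)
  then show ?thesis by simp
qed

lemma path_space_dist:
  assumes "B \<in> mspace path_space" "B' \<in> mspace path_space"
  shows "mdist path_space B B' \<le> r \<longleftrightarrow> (\<forall>t\<in>{0..1}. \<bar>B t - B' t\<bar> \<le> r)"
  using cfunspace_mdist_le[of B "top_of_set {0..1}" euclidean_metric B' r] assms
  unfolding path_space_def by (simp add: dist_real_def)

text \<open>On [0, n] the right-hand side is 1, so the hats form a partition of unity. The formula
  beyond n is what the induction uses.\<close>

lemma sum_hat:
  assumes "0 \<le> (s :: real)"
  shows "(\<Sum>i<Suc n. max 0 (1 - \<bar>s - real i\<bar>)) = max 0 (min 1 (real n + 1 - s))"
proof (induction n)
  case 0
  then show ?case using assms by simp
next
  case (Suc n)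
  then show ?case using assms by (subst sum.lessThan_Suc) (auto simp: max_def min_def abs_if)
qed

lemma polygonal_path_in_space: "polygonal_path qs \<in> mspace path_space"
  unfolding mspace_path_space polygonal_path_def
  by (intro conjI restrict_extensional)
    (rule continuous_on_eq[where f = "\<lambda>t. \<Sum>i<length qs. qs ! i * max 0 (1 - \<bar>real (length qs - 1) * t - real i\<bar>)"],
      auto intro!: continuous_intros)

lemma polygonal_path_node:
  assumes "length qs = Suc n" "0 < n" "i \<le> n"
  shows "polygonal_path qs (real i / real n) = qs ! i"
proof -
  have "polygonal_path qs (real i / real n) =
      (\<Sum>j<Suc n. qs ! j * max 0 (1 - \<bar>real i - real j\<bar>))"
    using assms by (simp add: polygonal_path_def)
  also have "\<dots> = (\<Sum>j<Suc n. if j = i then qs ! j else 0)"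
  proof (intro sum.cong refl)
    fix j
    have "1 \<le> \<bar>real i - real j\<bar>" if "j \<noteq> i" using that by linarith
    then show "qs ! j * max 0 (1 - \<bar>real i - real j\<bar>) = (if j = i then qs ! j else 0)"
      by (auto simp: max_def)
  qed
  also have "\<dots> = qs ! i" using assms by (subst sum.delta) auto
  finally show ?thesis .
qed

text \<open>The value at \<open>t\<close> is a convex combination of the values at the nodes closer
  to \<open>t\<close> than one mesh width.\<close>

lemma polygonal_path_close:
  assumes "length qs = Suc n" "0 < n" "t \<in> {0..1}"
    and close: "\<And>i. i \<le> n \<Longrightarrow> \<bar>t - real i / real n\<bar> < 1 / real n \<Longrightarrow> \<bar>qs ! i - y\<bar> \<le> \<eta>"
  shows "\<bar>polygonal_path qs t - y\<bar> \<le> \<eta>"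
proof -
  let ?h = "\<lambda>i. max 0 (1 - \<bar>real n * t - real i\<bar>)"
  have nt: "0 \<le> real n * t" "real n * t \<le> real n" using assms by (auto intro: mult_left_le)
  have one: "(\<Sum>i<Suc n. ?h i) = 1" unfolding sum_hat[OF nt(1)] using nt(2) by (simp add: max_def min_def)
  have "polygonal_path qs t = (\<Sum>i<Suc n. qs ! i * ?h i)"
    using assms by (simp add: polygonal_path_def)
  then have "polygonal_path qs t - y = (\<Sum>i<Suc n. qs ! i * ?h i) - y * (\<Sum>i<Suc n. ?h i)"
    using one by simp
  also have "\<dots> = (\<Sum>i<Suc n. (qs ! i - y) * ?h i)"
    unfolding sum_distrib_left sum_subtractf[symmetric] by (intro sum.cong) (auto simp: algebra_simps)
  finally have "\<bar>polygonal_path qs t - y\<bar> \<le> (\<Sum>i<Suc n. \<bar>(qs ! i - y) * ?h i\<bar>)"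
    by (simp only: sum_abs)
  also have "\<dots> \<le> (\<Sum>i<Suc n. \<eta> * ?h i)"
  proof (intro sum_mono)
    fix i assume i: "i \<in> {..<Suc n}"
    show "\<bar>(qs ! i - y) * ?h i\<bar> \<le> \<eta> * ?h i"
    proof (cases "\<bar>real n * t - real i\<bar> < 1")
      case True
      have "t - real i / real n = (real n * t - real i) / real n"
        using assms(2) by (simp add: field_simps)
      then have "\<bar>t - real i / real n\<bar> < 1 / real n"
        using True assms(2) by (simp add: abs_divide divide_strict_right_mono)
      then have "\<bar>qs ! i - y\<bar> \<le> \<eta>" using close i by simp
      then show ?thesis unfolding abs_mult by (intro mult_mono) auto
    qed (simp add: max_def)
  qed
  also have "\<dots> = \<eta>" unfolding sum_distrib_left[symmetric] one by simp
  finally show ?thesis .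
qed

lemma rat_of_code_dense:
  assumes "0 < \<eta>"
  shows "\<exists>k. \<bar>rat_of_code k - r\<bar> < \<eta>"
proof -
  obtain n where n: "1 / real (Suc n) < \<eta>" using assms nat_approx_posE by (metis of_nat_Suc)
  define a where "a = \<lfloor>r * real (Suc n)\<rfloor>"
  have "rat_of_code (prod_encode (int_encode a, n)) = of_int a / real (Suc n)"
    by (simp add: rat_of_code_def)
  moreover have "\<bar>of_int a / real (Suc n) - r\<bar> \<le> 1 / real (Suc n)"
  proof -
    have "\<bar>of_int a - r * real (Suc n)\<bar> \<le> 1" unfolding a_def by linarith
    moreover have "of_int a / real (Suc n) - r = (of_int a - r * real (Suc n)) / real (Suc n)"
      by (simp add: field_simps del: of_nat_Suc)
    ultimately show ?thesis by (simp add: abs_divide divide_right_mono del: of_nat_Suc)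
  qed
  ultimately show ?thesis using n by (metis order_le_less_trans)
qed

text \<open>Half of \<eta> is spent on uniform continuity over one mesh width, half on rounding the
  values to rationals. The grid is dyadic, so from level \<open>m\<close> on it contains the ends of
  all cells of strings of length at most \<open>m\<close>.\<close>

lemma polygonal_approx_at_zero:
  assumes B: "B \<in> mspace path_space" "B x = 0" and x: "0 < x" "x \<le> 1" and "0 < \<eta>"
  shows "\<exists>n\<ge>m. \<exists>ks. length ks = Suc (2 ^ n) \<and>
      mdist path_space (polygonal_path (map rat_of_code ks)) B \<le> \<eta> \<and>
      \<bar>rat_of_code (ks ! nat \<lceil>x * 2 ^ n\<rceil>)\<bar> \<le> \<eta>"
proof -
  have "uniformly_continuous_on {0..1} B"
    using B(1) by (intro compact_uniformly_continuous) (auto simp: mspace_path_space)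
  moreover have "0 < \<eta> / 2" using assms(5) by simp
  ultimately obtain \<delta> where \<delta>: "0 < \<delta>"
    "\<And>s t. s \<in> {0..1} \<Longrightarrow> t \<in> {0..1} \<Longrightarrow> \<bar>s - t\<bar> < \<delta> \<Longrightarrow> \<bar>B s - B t\<bar> < \<eta> / 2"
    unfolding uniformly_continuous_on_def dist_real_def by metis
  obtain n0 where n0: "(1 / 2) ^ n0 < \<delta>" using real_arch_pow_inv[OF \<delta>(1), of "1/2"] by auto
  define n where "n = max m n0"
  define L :: nat where "L = 2 ^ n"
  have L: "0 < L" "real L = 2 ^ n" by (auto simp: L_def)
  have "(1 / 2 :: real) ^ n \<le> (1 / 2) ^ n0" by (rule power_decreasing) (auto simp: n_def)
  then have L\<delta>: "1 / real L < \<delta>" using n0 by (simp add: L power_divide)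
  obtain q where q: "\<And>r. \<bar>rat_of_code (q r) - r\<bar> < \<eta> / 2"
    using rat_of_code_dense[OF \<open>0 < \<eta> / 2\<close>] by metis
  define ks where "ks = map (\<lambda>i. q (B (real i / real L))) [0..<Suc L]"
  have ks: "length ks = Suc L" by (simp add: ks_def)
  have close: "\<bar>rat_of_code (ks ! i) - B t\<bar> \<le> \<eta>"
    if "i \<le> L" "t \<in> {0..1}" "\<bar>t - real i / real L\<bar> \<le> 1 / real L" for i t
  proof -
    have "ks ! i = q (B (real i / real L))" using that(1) by (simp add: ks_def del: upt_Suc)
    then have "\<bar>rat_of_code (ks ! i) - B (real i / real L)\<bar> < \<eta> / 2" using q by simp
    moreover have "\<bar>B t - B (real i / real L)\<bar> < \<eta> / 2"
      using that L\<delta> L(1) by (intro \<delta>(2)) auto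
    ultimately show ?thesis by linarith
  qed
  have "\<bar>polygonal_path (map rat_of_code ks) t - B t\<bar> \<le> \<eta>" if "t \<in> {0..1}" for t
    using that L ks close by (intro polygonal_path_close[where n = L]) auto
  then have "mdist path_space (polygonal_path (map rat_of_code ks)) B \<le> \<eta>"
    using path_space_dist[OF polygonal_path_in_space B(1)] by blast
  moreover have "\<bar>rat_of_code (ks ! nat \<lceil>x * 2 ^ n\<rceil>)\<bar> \<le> \<eta>"
  proof -
    let ?i = "nat \<lceil>x * 2 ^ n\<rceil>"
    have xL: "0 < x * real L" "x * real L \<le> real L" using x L(1) by (auto simp: mult_le_cancel_right1)
    then have i: "x * real L \<le> real ?i" "real ?i \<le> x * real L + 1" and iL: "?i \<le> L"
      unfolding L(2)[symmetric] by linarith+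
    have "\<bar>real ?i - x * real L\<bar> \<le> 1" using i by linarith
    moreover have "x - real ?i / real L = - ((real ?i - x * real L) / real L)"
      using L(1) by (simp add: field_simps)
    ultimately have "\<bar>x - real ?i / real L\<bar> \<le> 1 / real L"
      by (simp add: abs_divide divide_right_mono)
    then show ?thesis using close[OF iL, of x] x B(2) by simp
  qed
  moreover have "m \<le> n" by (simp add: n_def)
  ultimately show ?thesis using ks unfolding L_def by blast
qed

text \<open>\<open>int_decode\<close> sends 2 * a to a and 2 * a + 1 to -a - 1; this is the absolute
  value of the result.\<close>

definition code_numerator :: "nat \<Rightarrow> nat" where
  "code_numerator k = (fst (prod_decode k) + 1) div 2"

definition code_denominator :: "nat \<Rightarrow> nat" where
  "code_denominator k = Suc (snd (prod_decode k))"

lemma abs_rat_of_code: "\<bar>rat_of_code k\<bar> = real (code_numerator k) / real (code_denominator k)"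
proof -
  have "\<bar>real_of_int (int_decode u)\<bar> = real ((u + 1) div 2)" for u
    by (cases "even u") (auto simp: int_decode_def sum_decode_def elim!: evenE oddE)
  then show ?thesis
    by (simp add: rat_of_code_def code_numerator_def code_denominator_def split_beta abs_divide)
qed

text \<open>A strict inequality between rationals with denominators cleared, so that it is decidable
  by arithmetic on naturals.\<close>

definition small_codes :: "nat \<Rightarrow> nat \<Rightarrow> nat \<Rightarrow> bool" where
  "small_codes p q h \<longleftrightarrow>
     (code_numerator p * code_denominator q + code_numerator q * code_denominator p) * 2 ^ h
       < code_denominator p * code_denominator q"

lemma small_codes_iff: "small_codes p q h \<longleftrightarrow> \<bar>rat_of_code p\<bar> + \<bar>rat_of_code q\<bar> < 1 / 2 ^ h"
proof -
  have pos: "0 < real (code_denominator p)" "0 < real (code_denominator q)"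
    by (simp_all add: code_denominator_def)
  have "small_codes p q h \<longleftrightarrow>
      real ((code_numerator p * code_denominator q + code_numerator q * code_denominator p) * 2 ^ h)
       < real (code_denominator p * code_denominator q)"
    unfolding small_codes_def by (simp only: of_nat_less_iff)
  also have "\<dots> \<longleftrightarrow> \<bar>rat_of_code p\<bar> + \<bar>rat_of_code q\<bar> < 1 / 2 ^ h"
    unfolding abs_rat_of_code using pos by (simp add: field_simps)
  finally show ?thesis .
qed

text \<open>This bound depends on the code of the ball only, so smallness at a node is certified for
  all its paths simultaneously.\<close>

lemma ideal_ball_node:
  assumes B: "B \<in> ideal_ball k" and n: "length (list_decode (fst (prod_decode k))) = Suc n" "0 < n" "i \<le> n"
  shows "\<bar>B (real i / real n)\<bar> <
    \<bar>rat_of_code (list_decode (fst (prod_decode k)) ! i)\<bar> + \<bar>rat_of_code (snd (prod_decode k))\<bar>"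
proof -
  let ?l = "list_decode (fst (prod_decode k))" and ?r = "rat_of_code (snd (prod_decode k))"
  let ?p = "polygonal_path (map rat_of_code ?l)"
  have B': "B \<in> mspace path_space" "mdist path_space ?p B < ?r"
    using B by (auto simp: ideal_ball_def ideal_path_def split_beta)
  have "\<bar>?p (real i / real n) - B (real i / real n)\<bar> \<le> mdist path_space ?p B"
    using path_space_dist[OF polygonal_path_in_space B'(1),
        of "map rat_of_code ?l" "mdist path_space ?p B"] n by simp
  moreover have "?p (real i / real n) = rat_of_code (?l ! i)"
    using polygonal_path_node[of "map rat_of_code ?l" n i] n by simp
  ultimately show ?thesis using B'(2) by linarith
qed

section \<open>The Martin-Loef test\<close>

text \<open>Membership of i / n in the cell of the string with code \<open>y\<close>, in integer
  form; the subtraction removes the leading 1 of the code.\<close>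

definition in_cell :: "nat \<Rightarrow> nat \<Rightarrow> nat \<Rightarrow> bool" where
  "in_cell y n i \<longleftrightarrow>
     (y - 2 ^ code_length y) * n \<le> i * 2 ^ code_length y \<and>
     i * 2 ^ code_length y \<le> (y - 2 ^ code_length y + 1) * n"

definition cell_ends_after :: "nat \<Rightarrow> nat \<Rightarrow> bool" where
  "cell_ends_after d y \<longleftrightarrow> 2 ^ code_length y \<le> (y - 2 ^ code_length y + 1) * 2 ^ d"

lemma in_cell_iff:
  assumes "0 < n"
  shows "in_cell (str_code \<sigma>) n i \<longleftrightarrow> real i / real n \<in> {cell_left \<sigma>..cell_right \<sigma>}"
proof -
  let ?a = "str_code \<sigma> - 2 ^ length \<sigma>" and ?N = "2 ^ length \<sigma> :: nat"
  have "?a * n \<le> i * ?N \<longleftrightarrow> real (?a * n) \<le> real (i * ?N)" by (simp only: of_nat_le_iff)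
  also have "\<dots> \<longleftrightarrow> cell_left \<sigma> \<le> real i / real n"
    using assms by (simp add: cell_left_def field_simps del: of_nat_diff)
  finally have 1: "?a * n \<le> i * ?N \<longleftrightarrow> cell_left \<sigma> \<le> real i / real n" .
  have "i * ?N \<le> (?a + 1) * n \<longleftrightarrow> real (i * ?N) \<le> real ((?a + 1) * n)" by (simp only: of_nat_le_iff)
  also have "\<dots> \<longleftrightarrow> real i / real n \<le> real (?a + 1) / real ?N"
    using assms by (simp add: field_simps)
  also have "real (?a + 1) / real ?N = cell_right \<sigma>"
    by (simp add: cell_right_def cell_left_def add_divide_distrib)
  finally show ?thesis using 1 by (simp add: in_cell_def)
qed

lemma cell_ends_after_iff: "cell_ends_after d (str_code \<sigma>) \<longleftrightarrow> 1 / 2 ^ d \<le> cell_right \<sigma>"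
proof -
  let ?a = "str_code \<sigma> - 2 ^ length \<sigma>" and ?N = "2 ^ length \<sigma> :: nat"
  have "?N \<le> (?a + 1) * 2 ^ d \<longleftrightarrow> real ?N \<le> real ((?a + 1) * 2 ^ d)" by (simp only: of_nat_le_iff)
  also have "\<dots> \<longleftrightarrow> 1 / 2 ^ d \<le> real (?a + 1) / real ?N"
    by (simp add: field_simps)
  also have "real (?a + 1) / real ?N = cell_right \<sigma>"
    by (simp add: cell_right_def cell_left_def add_divide_distrib)
  finally show ?thesis by (simp add: cell_ends_after_def)
qed

text \<open>\<open>R w r y\<close>: the machine \<open>U\<close> halts on the program with code \<open>r\<close> with output \<open>y\<close>, as witnessed by \<open>w\<close>.\<close>

locale zero_test = wiener W for W +
  fixes U :: "bool list \<rightharpoonup> bool list" and R :: "nat \<Rightarrow> nat \<Rightarrow> nat \<Rightarrow> bool" and d :: nat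
  assumes prefix_free: "prefix_free_machine U"
    and R: "(\<exists>w. R w r y) \<longleftrightarrow> (\<exists>\<rho> \<tau>. r = str_code \<rho> \<and> U \<rho> = Some \<tau> \<and> y = str_code \<tau>)"
    and decidable_R: "decidable (\<lambda>e. R (e 0) (e 1) (e 2))"
begin

text \<open>\<open>k\<close> codes centre and radius of a ball, \<open>i\<close> is the node at time
  i / n, and the stage \<open>s\<close> bounds the search for a halting witness. The node must lie
  in the cell of the output and certify a small value there.\<close>

definition counted :: "nat \<Rightarrow> nat \<Rightarrow> nat \<Rightarrow> nat \<Rightarrow> nat \<Rightarrow> nat \<Rightarrow> bool" where
  "counted k n i s r y \<longleftrightarrow> (\<exists>w<s. R w r y) \<and> cell_ends_after d y \<and> in_cell y n i \<and>
     small_codes (code_nth (fst (prod_decode k)) i) (snd (prod_decode k)) (code_length y div 2)"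

text \<open>The factor \<open>2 ^ s\<close> makes the weights \<open>2 ^ (|\<sigma>| div 2 - |\<rho>|)\<close> of the programs below \<open>s\<close> integral.\<close>

definition stage_sum :: "nat \<Rightarrow> nat \<Rightarrow> nat \<Rightarrow> nat \<Rightarrow> nat" where
  "stage_sum k n i s =
     (\<Sum>r<s. \<Sum>y<s. of_bool (counted k n i s r y) * 2 ^ (s - code_length r + code_length y div 2))"

text \<open>The \<open>s\<close> in the exponent compensates the scaling of
  \<open>stage_sum\<close>. All programs are counted at the same node.\<close>

definition test_codes :: "nat \<Rightarrow> nat set" where
  "test_codes m = {k. \<exists>n i s. 0 < i \<and> i \<le> n \<and> length (list_decode (fst (prod_decode k))) = Suc n \<and>
     2 ^ (s + m + d + 4) < stage_sum k n i s}"

lemma decidable_counted: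
  assumes "recursive K" "recursive N" "recursive I" "recursive S" "recursive A" "recursive Y"
  shows "decidable (\<lambda>e. counted (K e) (N e) (I e) (S e) (A e) (Y e))"
proof -
  have R': "decidable (\<lambda>e. R (F e) (G e) (H e))" if "recursive F" "recursive G" "recursive H" for F G H
    using recursive_fun3[of "\<lambda>a b c. of_bool (R a b c)"] that decidable_R unfolding decidable_def by simp
  have shift: "recursive (\<lambda>e. F (\<lambda>i. e (Suc i)))" if "recursive F" for F
    using that by (rule recursive_subst) (rule recursive_var)
  show ?thesis
    unfolding counted_def cell_ends_after_def in_cell_def small_codes_def code_numerator_def
      code_denominator_def
    by (intro recursive_intros R' recursive_code_length recursive_code_nth recursive_prod_decode
        recursive_div2 shift assms)
qed

lemma uniformly_ce_test_codes: "uniformly_ce test_codes"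
proof -
  have sum: "recursive (\<lambda>e. stage_sum (K e) (N e) (I e) (S e))"
    if "recursive K" "recursive N" "recursive I" "recursive S" for K N I S
  proof -
    have shift: "recursive (\<lambda>e. F (\<lambda>i. e (Suc i)))" if "recursive F" for F
      using that by (rule recursive_subst) (rule recursive_var)
    have shift2: "recursive (\<lambda>e. F (\<lambda>i. e (Suc (Suc i))))" if "recursive F" for F
      using that by (rule recursive_subst) (rule recursive_var)
    have "decidable (\<lambda>e. counted (K (\<lambda>i. e (Suc (Suc i)))) (N (\<lambda>i. e (Suc (Suc i))))
        (I (\<lambda>i. e (Suc (Suc i)))) (S (\<lambda>i. e (Suc (Suc i)))) (e 1) (e 0))"
      using that by (intro decidable_counted shift2 recursive_var)
    then have counted: "recursive (\<lambda>e. of_bool (counted (K (\<lambda>i. e (Suc (Suc i)))) (N (\<lambda>i. e (Suc (Suc i))))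
        (I (\<lambda>i. e (Suc (Suc i)))) (S (\<lambda>i. e (Suc (Suc i)))) (e (Suc 0)) (e 0)))"
      by (simp add: decidable_def)
    show ?thesis
      unfolding stage_sum_def
      by (intro recursive_sum recursive_mult counted recursive_power recursive_add recursive_diff
          recursive_code_length recursive_div2 recursive_var recursive_const shift shift2 that)
  qed
  have "semidecidable (\<lambda>e. \<exists>n i s. 0 < i \<and> i \<le> n \<and>
      (\<not> code_drop n (fst (prod_decode (e 1))) = 0 \<and> code_drop (Suc n) (fst (prod_decode (e 1))) = 0) \<and>
      2 ^ (s + e 0 + d + 4) < stage_sum (e 1) n i s)"
    by (intro semidecidable_ex semidecidable_decidable recursive_intros recursive_code_drop
        recursive_prod_decode sum)
  from semidecidable_domain[OF this] show ?thesis
    unfolding uniformly_ce_def test_codes_def by (simp add: length_list_decode_iff)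
qed

section \<open>Measure of the test\<close>

definition cell_hit :: "bool list \<Rightarrow> (real \<Rightarrow> real) set" where
  "cell_hit \<sigma> = (if 1 / 2 ^ d \<le> cell_right \<sigma>
     then hit (cell_left \<sigma>) (cell_right \<sigma>) (1 / 2 ^ (length \<sigma> div 2)) else {})"

lemma cell_hit_measurable [measurable]: "cell_hit \<sigma> \<in> sets W"
  using hit_measurable cell_bounds(3) by (simp add: cell_hit_def)

text \<open>Origin of the exponent: 12 \<le> 2 ^ 4, and \<open>sqrt (cell_right \<sigma>)\<close> is
  at least 2 ^ -d, because 2 ^ -d is at most its own square root.\<close>

lemma cell_hit_prob: "2 ^ (length \<sigma> div 2) * prob (cell_hit \<sigma>) \<le> 2 ^ (d + 4)"
proof (cases "1 / 2 ^ d \<le> cell_right \<sigma>")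
  case True
  let ?h = "length \<sigma> div 2"
  have pos: "0 < cell_right \<sigma>" using True by (meson less_le_trans zero_less_divide_1_iff zero_less_numeral zero_less_power)
  have "cell_right \<sigma> - cell_left \<sigma> \<le> (1 / 2 ^ ?h)\<^sup>2"
  proof -
    have "(2 :: real) ^ (?h * 2) \<le> 2 ^ length \<sigma>" by (rule power_increasing) auto
    then show ?thesis
      by (simp add: cell_right_def power_divide frac_le flip: power_mult)
  qed
  then have "prob (cell_hit \<sigma>) \<le> 12 * (1 / 2 ^ ?h) / sqrt (cell_right \<sigma>)"
    using True pos cell_bounds(3) hit_prob[of "cell_right \<sigma>" "1 / 2 ^ ?h" "cell_left \<sigma>"]
    by (simp add: cell_hit_def)
  also have "\<dots> \<le> 12 * (1 / 2 ^ ?h) / (1 / 2 ^ d)"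
  proof (intro divide_left_mono)
    have "(1 / 2 ^ d)\<^sup>2 \<le> (1 / 2 ^ d :: real)"
      by (simp add: power2_eq_square mult_le_cancel_left1 divide_simps)
    then show "1 / 2 ^ d \<le> sqrt (cell_right \<sigma>)"
      using True by (intro real_le_rsqrt) linarith
  qed (use pos in auto)
  finally have "2 ^ ?h * prob (cell_hit \<sigma>) \<le> 2 ^ ?h * (12 * (1 / 2 ^ ?h) / (1 / 2 ^ d))"
    by (intro mult_left_mono) auto
  also have "\<dots> = 12 * 2 ^ d" by simp
  also have "\<dots> \<le> 2 ^ (d + 4)" by (simp add: power_add)
  finally show ?thesis .
qed (simp add: cell_hit_def)

text \<open>The random sum over programs, with actual small values in place of certified ones.
  Finite sets \<open>F\<close> avoid infinite sums.\<close>

definition mass :: "bool list set \<Rightarrow> (real \<Rightarrow> real) \<Rightarrow> real" where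
  "mass F B = (\<Sum>\<rho>\<in>F. (1 / 2) ^ length \<rho> * (2 ^ (length (the (U \<rho>)) div 2) * indicator (cell_hit (the (U \<rho>))) B))"

lemma mass_measurable [measurable]: "mass F \<in> borel_measurable W"
  unfolding mass_def by measurable

lemma mass_mono: "finite G \<Longrightarrow> F \<subseteq> G \<Longrightarrow> mass F B \<le> mass G B"
  unfolding mass_def by (rule sum_mono2) auto

text \<open>Kraft's inequality bounds the expectation by 2 ^ (d + 4) for every \<open>F\<close>, so
  Markov's inequality leaves exactly 2 ^ -m.\<close>

lemma mass_tail:
  assumes F: "finite F" "F \<subseteq> dom U"
  shows "prob {B \<in> space W. 2 ^ (m + d + 4) < mass F B} \<le> 1 / 2 ^ m"
proof -
  have int_cell: "integrable W (indicator (cell_hit \<sigma>) :: _ \<Rightarrow> real)" for \<sigma>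
    by (intro integrable_real_indicator cell_hit_measurable) (simp add: emeasure_eq_measure)
  then have int: "integrable W (mass F)"
    unfolding mass_def by (intro Bochner_Integration.integrable_sum integrable_mult_right)
  have "expectation (mass F) =
      (\<Sum>\<rho>\<in>F. (1 / 2) ^ length \<rho> * (2 ^ (length (the (U \<rho>)) div 2) * prob (cell_hit (the (U \<rho>)))))"
    unfolding mass_def using int_cell by (subst Bochner_Integration.integral_sum) auto
  also have "\<dots> \<le> (\<Sum>\<rho>\<in>F. (1 / 2) ^ length \<rho> * 2 ^ (d + 4))"
    by (intro sum_mono mult_left_mono cell_hit_prob) auto
  also have "\<dots> = (\<Sum>\<rho>\<in>F. (1 / 2) ^ length \<rho>) * 2 ^ (d + 4)" by (rule sum_distrib_right[symmetric])
  also have "(\<Sum>\<rho>\<in>F. (1 / 2) ^ length \<rho>) * 2 ^ (d + 4) \<le> (1 :: real) * 2 ^ (d + 4)"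
  proof (intro mult_right_mono kraft_inequality F(1) ballI allI impI)
    fix \<sigma> \<rho> :: "bool list" assume "\<sigma> \<in> F" "\<rho> \<noteq> []"
    then show "\<sigma> @ \<rho> \<notin> F" using F(2) prefix_free unfolding prefix_free_machine_def by blast
  qed simp
  finally have E: "expectation (mass F) \<le> 2 ^ (d + 4)" by simp
  have "prob {B \<in> space W. 2 ^ (m + d + 4) < mass F B} \<le> prob {B \<in> space W. 2 ^ (m + d + 4) \<le> mass F B}"
    by (intro finite_measure_mono) auto
  also have "\<dots> \<le> expectation (mass F) / 2 ^ (m + d + 4)"
    by (rule integral_Markov_inequality_measure[OF int, of "{}"])
      (auto simp: mass_def intro!: sum_nonneg)
  also have "\<dots> \<le> 2 ^ (d + 4) / 2 ^ (m + d + 4)" using E by (intro divide_right_mono) auto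
  also have "\<dots> = 1 / 2 ^ m" by (simp add: power_add)
  finally show ?thesis .
qed

lemma stage_sum_eq:
  "stage_sum k n i s = (\<Sum>(r, y)\<in>{(r, y). r < s \<and> y < s \<and> counted k n i s r y}.
     2 ^ (s - code_length r + code_length y div 2))"
proof -
  have "stage_sum k n i s = (\<Sum>p\<in>{..<s} \<times> {..<s}. if counted k n i s (fst p) (snd p)
      then 2 ^ (s - code_length (fst p) + code_length (snd p) div 2) else 0)"
    unfolding stage_sum_def sum.cartesian_product by (intro sum.cong) auto
  also have "\<dots> = (\<Sum>p\<in>{p \<in> {..<s} \<times> {..<s}. counted k n i s (fst p) (snd p)}.
      2 ^ (s - code_length (fst p) + code_length (snd p) div 2))"
    by (rule sum.inter_filter[symmetric]) simp
  also have "{p \<in> {..<s} \<times> {..<s}. counted k n i s (fst p) (snd p)} =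
      {(r, y). r < s \<and> y < s \<and> counted k n i s r y}" by auto
  finally show ?thesis by (simp add: split_beta)
qed

definition programs_below :: "nat \<Rightarrow> bool list set" where
  "programs_below s = {\<rho> \<in> dom U. str_code \<rho> < s}"

lemma finite_programs_below: "finite (programs_below s)"
proof -
  have "inj str_code" by (simp add: inj_def str_code_inject)
  then have "finite (str_code -` {..<s})" by (intro finite_vimageI) auto
  then show ?thesis by (rule rev_finite_subset) (auto simp: programs_below_def)
qed

text \<open>A program is shorter than its code and hence than \<open>s\<close>, so the truncated
  subtraction in the exponent is a true one.\<close>

lemma program_weight:
  assumes "str_code \<rho> < s"
  shows "real (2 ^ (s - length \<rho> + h)) = 2 ^ s * ((1 / 2) ^ length \<rho> * 2 ^ h)"
proof -
  have "length \<rho> < 2 ^ length \<rho>" by simp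
  then have "length \<rho> \<le> s" using str_code_bounds(1)[of \<rho>] assms by linarith
  then have "(2 :: real) ^ s = 2 ^ (s - length \<rho>) * 2 ^ length \<rho>" by (simp flip: power_add)
  then show ?thesis by (simp add: power_add power_divide)
qed

text \<open>Each counted pair comes from a program below \<open>s\<close> whose output cell is
  really hit by \<open>B\<close>, and distinct pairs come from distinct programs.
  \<open>B 0 = 0\<close> turns the small value at the node into a small increment.\<close>

lemma test_ball_mass:
  assumes k: "k \<in> test_codes m" and B: "B \<in> ideal_ball k" "B \<in> space W" "B 0 = 0"
  shows "\<exists>s. 2 ^ (m + d + 4) < mass (programs_below s) B"
proof -
  obtain n i s where nis: "0 < i" "i \<le> n" "length (list_decode (fst (prod_decode k))) = Suc n"
    "2 ^ (s + m + d + 4) < stage_sum k n i s" using k by (auto simp: test_codes_def)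
  let ?P = "{(r, y). r < s \<and> y < s \<and> counted k n i s r y}"
  define F where "F = {\<rho> \<in> programs_below s. B \<in> cell_hit (the (U \<rho>))}"
  let ?f = "\<lambda>\<rho>. (str_code \<rho>, str_code (the (U \<rho>)))"
  have F: "finite F" unfolding F_def using finite_programs_below by simp
  have nth: "code_nth (fst (prod_decode k)) i = list_decode (fst (prod_decode k)) ! i"
    using code_nth_list_encode[of i "list_decode (fst (prod_decode k))"] nis by simp
  have "?P \<subseteq> ?f ` F"
  proof
    fix p assume "p \<in> ?P"
    then obtain r y where p: "p = (r, y)" "r < s" "counted k n i s r y" by auto
    then obtain \<rho> \<tau> where \<rho>: "r = str_code \<rho>" "U \<rho> = Some \<tau>" "y = str_code \<tau>"
      using R unfolding counted_def by blast
    have "\<bar>B (real i / real n)\<bar> < 1 / 2 ^ (length \<tau> div 2)"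
      using ideal_ball_node[OF B(1) nis(3), of i] nis(1,2) p(3) \<rho>(3)
      by (simp add: counted_def small_codes_iff nth)
    moreover have "real i / real n \<in> \<rat> \<inter> {cell_left \<tau>..cell_right \<tau>} \<inter> {0<..}"
      using p(3) \<rho>(3) nis(1,2) in_cell_iff[of n \<tau> i] by (simp add: counted_def)
    ultimately have "B \<in> hit (cell_left \<tau>) (cell_right \<tau>) (1 / 2 ^ (length \<tau> div 2))"
      using B unfolding hit_def by auto
    then have "B \<in> cell_hit \<tau>"
      using p(3) \<rho>(3) by (simp add: cell_hit_def counted_def cell_ends_after_iff)
    then show "p \<in> ?f ` F"
      using p \<rho> by (intro image_eqI[of _ _ \<rho>]) (auto simp: F_def programs_below_def)
  qed
  then have "stage_sum k n i s \<le> (\<Sum>(r, y)\<in>?f ` F. 2 ^ (s - code_length r + code_length y div 2))"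
    unfolding stage_sum_eq using F by (intro sum_mono2) auto
  also have "\<dots> = (\<Sum>\<rho>\<in>F. 2 ^ (s - length \<rho> + length (the (U \<rho>)) div 2))"
    by (subst sum.reindex) (auto simp: inj_on_def str_code_inject)
  finally have "2 ^ (s + m + d + 4) < (\<Sum>\<rho>\<in>F. 2 ^ (s - length \<rho> + length (the (U \<rho>)) div 2) :: nat)"
    using nis(4) by linarith
  then have "real (2 ^ (s + m + d + 4)) < real (\<Sum>\<rho>\<in>F. 2 ^ (s - length \<rho> + length (the (U \<rho>)) div 2))"
    by (simp only: of_nat_less_iff)
  also have "\<dots> = (\<Sum>\<rho>\<in>F. 2 ^ s * ((1 / 2) ^ length \<rho> * 2 ^ (length (the (U \<rho>)) div 2)))"
    unfolding of_nat_sum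
    by (intro sum.cong refl program_weight) (auto simp: F_def programs_below_def)
  also have "\<dots> = 2 ^ s * (\<Sum>\<rho>\<in>F. (1 / 2) ^ length \<rho> * 2 ^ (length (the (U \<rho>)) div 2))"
    by (rule sum_distrib_left[symmetric])
  also have "(\<Sum>\<rho>\<in>F. (1 / 2) ^ length \<rho> * 2 ^ (length (the (U \<rho>)) div 2)) = mass F B"
    unfolding mass_def by (intro sum.cong) (auto simp: F_def)
  also have "mass F B \<le> mass (programs_below s) B"
    by (intro mass_mono finite_programs_below) (auto simp: F_def)
  finally have "2 ^ s * 2 ^ (m + d + 4) < 2 ^ s * mass (programs_below s) B"
    by (simp add: power_add mult_ac)
  then show ?thesis by auto
qed

text \<open>The balls are covered by the events on \<open>mass\<close> almost surely, namely where
  \<open>B 0 = 0\<close>. The bound of \<open>mass_tail\<close> does not depend on the stage and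
  survives the limit.\<close>

lemma test_measure: "prob (\<Union>k\<in>test_codes m. ideal_ball k) \<le> 1 / 2 ^ m"
proof -
  let ?A = "\<lambda>s. {B \<in> space W. 2 ^ (m + d + 4) < mass (programs_below s) B}"
  have "incseq ?A"
  proof (rule incseq_SucI, rule Collect_mono, intro impI conjI)
    fix s B assume "B \<in> space W \<and> 2 ^ (m + d + 4) < mass (programs_below s) B"
    moreover have "mass (programs_below s) B \<le> mass (programs_below (Suc s)) B"
      by (intro mass_mono finite_programs_below) (auto simp: programs_below_def)
    ultimately show "B \<in> space W" "2 ^ (m + d + 4) < mass (programs_below (Suc s)) B" by auto
  qed
  then have lim: "(\<lambda>s. prob (?A s)) \<longlonglongrightarrow> prob (\<Union>s. ?A s)"
    by (intro finite_Lim_measure_incseq) auto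
  have "prob (?A s) \<le> 1 / 2 ^ m" for s
    by (intro mass_tail finite_programs_below) (auto simp: programs_below_def)
  then have "prob (\<Union>s. ?A s) \<le> 1 / 2 ^ m"
    using LIMSEQ_le_const2[OF lim] by blast
  moreover have "prob (\<Union>k\<in>test_codes m. ideal_ball k) \<le> prob (\<Union>s. ?A s)"
  proof (rule finite_measure_mono_AE)
    show "AE B in W. B \<in> (\<Union>k\<in>test_codes m. ideal_ball k) \<longrightarrow> B \<in> (\<Union>s. ?A s)"
      using AE_start AE_space by eventually_elim (use test_ball_mass in blast)
  qed auto
  ultimately show ?thesis by linarith
qed

lemma martin_loef_test_zero_test: "martin_loef_test W (\<lambda>m. \<Union>k\<in>test_codes m. ideal_ball k)"
  unfolding martin_loef_test_def uniformly_effectively_open_def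
  using uniformly_ce_test_codes test_measure by blast

section \<open>Capturing the paths with a zero at x\<close>

text \<open>The ball has radius 2 ^ -(l + 2) around a polygonal path at distance at most 2 ^ -(l +
  3) that is equally small at the chosen node. The sum stays below 2 ^ -l, which is small enough for
  all prefixes shorter than \<open>l\<close>; their shortest programs are then counted at a late
  stage.\<close>

lemma zero_in_test:
  assumes U: "optimal_prefix_free_machine U"
    and B: "B \<in> mspace path_space" "B x = 0" and x: "1 / 2 ^ d \<le> x" "x \<le> 1"
    and b: "binary_expansion x b"
    and large: "2 ^ (m + d + 4) <
      (\<Sum>j<l. (1 / 2) ^ prefix_complexity U (initial_bits b j) * 2 ^ (j div 2) :: real)"
  shows "B \<in> (\<Union>k\<in>test_codes m. ideal_ball k)"
proof -
  have x0: "0 < x" using x(1) by (meson less_le_trans zero_less_divide_1_iff zero_less_numeral zero_less_power)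
  obtain N ks where N: "l \<le> N" and ks: "length ks = Suc (2 ^ N)"
    "mdist path_space (polygonal_path (map rat_of_code ks)) B \<le> 1 / 2 ^ (l + 3)"
    "\<bar>rat_of_code (ks ! nat \<lceil>x * 2 ^ N\<rceil>)\<bar> \<le> 1 / 2 ^ (l + 3)"
    using polygonal_approx_at_zero[OF B x0 x(2), of "1 / 2 ^ (l + 3)" l] by auto
  \<comment> \<open>A code of 1 / 2 ^ (l + 2); the 1 is subtracted because
    \<open>rat_of_code\<close> divides by a successor.\<close>
  define rc where "rc = prod_encode (int_encode 1, 2 ^ (l + 2) - 1)"
  define k where "k = prod_encode (list_encode ks, rc)"
  define i where "i = nat \<lceil>x * 2 ^ N\<rceil>"
  have rc: "rat_of_code rc = 1 / 2 ^ (l + 2)"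
    by (simp add: rat_of_code_def rc_def of_nat_diff)
  have "(1 :: real) / 2 ^ (l + 3) < 1 / 2 ^ (l + 2)"
    by (intro divide_strict_left_mono power_strict_increasing) auto
  then have "B \<in> ideal_ball k"
    using ks(2) B(1) polygonal_path_in_space by (simp add: ideal_ball_def ideal_path_def k_def rc)
  have xN: "0 < x * 2 ^ N" "x * 2 ^ N \<le> 2 ^ N" using x0 x(2) by (auto simp: mult_le_cancel_right1)
  have i: "0 < i" "x * 2 ^ N \<le> real i" unfolding i_def using xN(1) by linarith+
  have i_le: "i \<le> q" if "x * 2 ^ N \<le> real q" for q :: nat
    unfolding i_def using that by linarith
  have iN: "i \<le> 2 ^ N" using xN(2) by (intro i_le) simp
  have small: "small_codes (code_nth (fst (prod_decode k)) i) (snd (prod_decode k)) (j div 2)"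
    if "j < l" for j
  proof -
    have "code_nth (list_encode ks) i = ks ! i"
      using ks(1) iN by (intro code_nth_list_encode) simp
    moreover have "\<bar>rat_of_code (ks ! i)\<bar> + \<bar>rat_of_code rc\<bar> < 1 / 2 ^ l"
    proof -
      have "(1 :: real) / 2 ^ (l + 3) + 1 / 2 ^ (l + 2) < 1 / 2 ^ l"
        by (simp add: power_add divide_simps)
      then show ?thesis using ks(3) rc by (simp add: i_def)
    qed
    moreover have "(1 :: real) / 2 ^ l \<le> 1 / 2 ^ (j div 2)"
      using that by (intro divide_left_mono power_increasing) auto
    ultimately show ?thesis by (simp add: small_codes_iff k_def)
  qed
  have cell: "in_cell (str_code (initial_bits b j)) (2 ^ N) i" if "j < l" for j
  proof -
    let ?\<sigma> = "initial_bits b j"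
    have "x \<le> real i / 2 ^ N" using i(2) by (simp add: field_simps)
    then have "cell_left ?\<sigma> \<le> real i / 2 ^ N"
      using binary_expansion_cell(1)[OF b, of j] by linarith
    moreover have "real i / 2 ^ N \<le> cell_right ?\<sigma>"
    proof -
      \<comment> \<open>The right end of the cell is the grid point \<open>?q / 2 ^ N\<close>, as
        \<open>j \<le> N\<close>. Since x does not exceed it, rounding x * 2 ^ N up to
        \<open>i\<close> cannot pass it.\<close>
      let ?q = "(str_code ?\<sigma> - 2 ^ j + 1) * 2 ^ (N - j)"
      have "(2 :: real) ^ N = 2 ^ (N - j) * 2 ^ j" using that N by (simp flip: power_add)
      then have q: "real ?q = cell_right ?\<sigma> * 2 ^ N"
        by (simp add: cell_right_def cell_left_def field_simps del: of_nat_diff)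
      have "x * 2 ^ N \<le> cell_right ?\<sigma> * 2 ^ N"
        using binary_expansion_cell(2)[OF b, of j] by simp
      then have "i \<le> ?q" unfolding q[symmetric] by (rule i_le)
      then have "real i \<le> real ?q" by (rule of_nat_mono)
      then show ?thesis unfolding q by (simp add: field_simps)
    qed
    ultimately show ?thesis using in_cell_iff[of "2 ^ N" ?\<sigma> i] by simp
  qed
  have ends: "cell_ends_after d (str_code (initial_bits b j))" for j
    using binary_expansion_cell(2)[OF b, of j] x(1) by (simp add: cell_ends_after_iff)
  have "\<exists>\<rho>. \<forall>j. U (\<rho> j) = Some (initial_bits b j) \<and>
      length (\<rho> j) = prefix_complexity U (initial_bits b j)"
    using prefix_complexity_witness[OF U] by (intro choice allI)
  then obtain \<rho> where \<rho>: "\<And>j. U (\<rho> j) = Some (initial_bits b j)"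
    "\<And>j. length (\<rho> j) = prefix_complexity U (initial_bits b j)"
    by blast
  have "\<exists>w. R w (str_code (\<rho> j)) (str_code (initial_bits b j))" for j
    using R \<rho>(1) by blast
  then obtain w where w: "\<And>j. R (w j) (str_code (\<rho> j)) (str_code (initial_bits b j))" by metis
  \<comment> \<open>A stage beyond the codes of all programs and outputs involved and beyond their
    halting witnesses; a sum is a convenient common bound.\<close>
  define t where "t j = str_code (\<rho> j) + str_code (initial_bits b j) + w j" for j
  define s where "s = Suc (\<Sum>j<l. t j)"
  have "t j < s" if "j < l" for j
    unfolding s_def using that by (intro le_imp_less_Suc member_le_sum) auto
  then have s: "str_code (\<rho> j) < s" "str_code (initial_bits b j) < s" "w j < s" if "j < l" for j
    using that unfolding t_def by fastforce+
  let ?f = "\<lambda>j. (str_code (\<rho> j), str_code (initial_bits b j))"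
  let ?P = "{(r, y). r < s \<and> y < s \<and> counted k (2 ^ N) i s r y}"
  have P: "?f ` {..<l} \<subseteq> ?P"
    using s w small cell ends by (fastforce simp: counted_def)
  have "?P \<subseteq> {..<s} \<times> {..<s}" by auto
  then have "finite ?P" by (rule finite_subset) simp
  \<comment> \<open>The outputs differ already in length, so no term is counted twice.\<close>
  have inj: "inj_on ?f {..<l}"
    by (rule inj_onI) (metis Pair_inject length_initial_bits str_code_inject)
  have "2 ^ s * 2 ^ (m + d + 4) <
      2 ^ s * (\<Sum>j<l. (1 / 2) ^ prefix_complexity U (initial_bits b j) * 2 ^ (j div 2) :: real)"
    using large by simp
  also have "\<dots> = real (\<Sum>j<l. 2 ^ (s - length (\<rho> j) + j div 2))"
    unfolding sum_distrib_left of_nat_sum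
    by (intro sum.cong refl) (simp only: \<rho>(2)[symmetric] program_weight[OF s(1)] lessThan_iff)
  also have "(\<Sum>j<l. 2 ^ (s - length (\<rho> j) + j div 2)) =
      (\<Sum>(r, y)\<in>?f ` {..<l}. 2 ^ (s - code_length r + code_length y div 2))"
    by (subst sum.reindex[OF inj]) simp
  also have "\<dots> \<le> stage_sum k (2 ^ N) i s"
    unfolding stage_sum_eq using \<open>finite ?P\<close> P by (intro sum_mono2) auto
  finally have "real (2 ^ (s + m + d + 4)) < real (stage_sum k (2 ^ N) i s)"
    by (simp add: power_add mult_ac)
  then have "2 ^ (s + m + d + 4) < stage_sum k (2 ^ N) i s" by (simp only: of_nat_less_iff)
  then have "k \<in> test_codes m"
    using i(1) iN ks(1) unfolding test_codes_def k_def by auto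
  then show ?thesis using \<open>B \<in> ideal_ball k\<close> by blast
qed

end

text \<open>The graph of \<open>U\<close> is a projection of a decidable relation. The number 0
  codes no string and the term may halt on it, hence the guard \<open>0 < e 0\<close>.\<close>

lemma partial_computable_stages:
  assumes "partial_computable_str U"
  shows "\<exists>R. decidable (\<lambda>e. R (e 0) (e 1) (e 2)) \<and>
    (\<forall>r y. (\<exists>w. R w r y) \<longleftrightarrow> (\<exists>\<rho> \<tau>. r = str_code \<rho> \<and> U \<rho> = Some \<tau> \<and> y = str_code \<tau>))"
proof -
  obtain g where g: "\<And>\<sigma> y. computes g [str_code \<sigma>] y \<longleftrightarrow> (\<exists>\<tau>. U \<sigma> = Some \<tau> \<and> y = str_code \<tau>)"
    using assms unfolding partial_computable_str_def by blast
  have "semidecidable (\<lambda>e. computes g (map (\<lambda>i. e 0) [0..<1]) (e 1))"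
    by (intro semidecidable_computes recursive_var)
  then have "semidecidable (\<lambda>e. computes g [e 0] (e 1))" by simp
  moreover have "semidecidable (\<lambda>e. 0 < e 0)"
    by (intro semidecidable_decidable recursive_intros)
  ultimately have "semidecidable (\<lambda>e. 0 < e 0 \<and> computes g [e 0] (e 1))"
    by (intro semidecidable_conj)
  then obtain Q where Q: "decidable (\<lambda>e. Q (e 0) (\<lambda>i. e (Suc i)))"
    "\<And>e. (0 < e 0 \<and> computes g [e 0] (e 1)) \<longleftrightarrow> (\<exists>w. Q w e)"
    unfolding semidecidable_def by blast
  define R where "R w r y = Q w (\<lambda>i. if i = 0 then r else y)" for w r y
  have "recursive (\<lambda>e. e (if i = 0 then 0 else if i = 1 then 1 else 2))" for i :: nat
    by (rule recursive_var)
  from decidable_subst[OF Q(1), of "\<lambda>i e. e (if i = 0 then 0 else if i = 1 then 1 else 2)", OF this]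
  have "decidable (\<lambda>e. R (e 0) (e 1) (e 2))" by (simp add: R_def if_distrib cong: if_cong)
  moreover have "(\<exists>w. R w r y) \<longleftrightarrow> (\<exists>\<rho> \<tau>. r = str_code \<rho> \<and> U \<rho> = Some \<tau> \<and> y = str_code \<tau>)" for r y
  proof -
    have "(\<exists>w. R w r y) \<longleftrightarrow> 0 < r \<and> computes g [r] y"
      unfolding R_def Q(2)[symmetric] by simp
    then show ?thesis using g str_code_surj str_code_pos by metis
  qed
  ultimately show ?thesis by blast
qed

theorem theorem4p9:
  fixes W :: "(real \<Rightarrow> real) measure" and U :: "bool list \<rightharpoonup> bool list"
    and x :: real and b :: "nat \<Rightarrow> bool"
  assumes "wiener_measure W"
    and "optimal_prefix_free_machine U"
    and "0 < x" and "x \<le> 1"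
    and "\<exists>B. martin_loef_random W B \<and> B x = 0"
    and "binary_expansion x b"
  shows "summable (\<lambda>n. 2 powr (- real (prefix_complexity U (initial_bits b n)) + real n / 2))"
proof -
  have U: "prefix_free_machine U" using assms(2) by (simp add: optimal_prefix_free_machine_def)
  then have "partial_computable_str U" by (simp add: prefix_free_machine_def)
  from partial_computable_stages[OF this]
  obtain R where R: "decidable (\<lambda>e. R (e 0) (e 1) (e 2))"
    "\<forall>r y. (\<exists>w. R w r y) \<longleftrightarrow> (\<exists>\<rho> \<tau>. r = str_code \<rho> \<and> U \<rho> = Some \<tau> \<and> y = str_code \<tau>)"
    by (elim exE conjE)
  obtain d where "(1 / 2) ^ d < x" using real_arch_pow_inv[OF assms(3), of "1/2"] by auto
  then have d: "1 / 2 ^ d \<le> x" by (simp add: power_divide)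
  interpret zero_test W U R d
    using assms(1) U R by unfold_locales (simp_all only: simp_thms)
  obtain B where B: "martin_loef_random W B" "B x = 0" using assms(5) by blast
  then obtain m where m: "B \<notin> (\<Union>k\<in>test_codes m. ideal_ball k)"
    using martin_loef_test_zero_test unfolding martin_loef_random_def by blast
  let ?g = "\<lambda>j. (1 / 2) ^ prefix_complexity U (initial_bits b j) * 2 ^ (j div 2) :: real"
  have "B \<in> mspace path_space" using B(1) by (simp add: martin_loef_random_def)
  \<comment> \<open>A level \<open>m\<close> of the test that misses \<open>B\<close> bounds all
    partial sums at once.\<close>
  then have "(\<Sum>j<l. ?g j) \<le> 2 ^ (m + d + 4)" for l
    using zero_in_test[where B = B and x = x and b = b and m = m and l = l] assms(2,4,6) B(2) d m
    by (meson not_le)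
  then have "summable ?g" by (intro summableI_nonneg_bounded) auto
  then have sum: "summable (\<lambda>j. 2 * ?g j)" by (rule summable_mult)
  have "norm (2 powr (- real (prefix_complexity U (initial_bits b j)) + real j / 2)) \<le> 2 * ?g j" for j
  proof -
    \<comment> \<open>Passing from j div 2 back to j / 2 costs at most a factor 2.\<close>
    have "real j / 2 \<le> real (j div 2 + 1)" by linarith
    then have "2 powr (real j / 2) \<le> 2 powr real (j div 2 + 1)" by (intro powr_mono) auto
    also have "\<dots> = 2 * 2 ^ (j div 2)" by (subst powr_realpow) auto
    finally have "2 powr (real j / 2) \<le> 2 * 2 ^ (j div 2)" .
    moreover have "2 powr (- real k + real j / 2) = (1 / 2) ^ k * 2 powr (real j / 2)" for k
      by (simp add: powr_diff powr_realpow power_one_over)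
    ultimately show ?thesis by simp
  qed
  then show ?thesis by (rule summable_comparison_test'[OF sum])
qed

end
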